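(* Let $\Omega\subset\mathbb H$ be an axially symmetric domain. Then $H^n(\Omega,\mathcal I\mathbb Z)=0$ for all $n\ge2$.
   Context: $\mathbb S=\{I\in\mathbb H:I^2=-1\}$, $\mathbb C_I^+=\{x+yI:y>0\}$. A set $E\subset\mathbb H$ is axially symmetric if $x+Iy\in E$ implies $x+Jy\in E$ for all $J\in\mathbb S$; an axially symmetric domain is a connected axially symmetric open set. The imaginary unit function $\mathcal I:\mathbb H\setminus\mathbb R\to\mathbb S$ is $\mathcal I(q)=I$ for $q\in\mathbb C_I^+$. For an axially symmetric open covering $\mathcal U=\{U_\lambda\}$ of $\Omega$, an $m$-cochain with coefficients in $\mathcal I\mathbb Z$ assigns to each intersection $U_L$ ($L$ a multi-index of the appropriate length) a continuous function of the form $f_L=n_L\,\mathcal I$ with $n_L\in\mathbb Z$ (so $n_L=0$ whenever $U_L\cap\mathbb R\neq\varnothing$). Coboundary operators are the usual Čech ones, and $H^n(\Omega,\mathcal I\mathbb Z)$ is the direct limit over axially symmetric open coverings of $\Omega$ of the resulting cohomology groups. *)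

theory Defs
  imports "HOL-Analysis.Analysis"
begin

type_synonym quat = "real^4"

definition qmult :: "quat \<Rightarrow> quat \<Rightarrow> quat" where
  "qmult p q = vector
     [p$1*q$1 - p$2*q$2 - p$3*q$3 - p$4*q$4,
      p$1*q$2 + p$2*q$1 + p$3*q$4 - p$4*q$3,
      p$1*q$3 - p$2*q$4 + p$3*q$1 + p$4*q$2,
      p$1*q$4 + p$2*q$3 - p$3*q$2 + p$4*q$1]"

definition qreal :: "real \<Rightarrow> quat" where
  "qreal x = vector [x, 0, 0, 0]"

definition qReals :: "quat set" where
  "qReals = range qreal"

definition qS :: "quat set" where
  "qS = {I. qmult I I = qreal (-1)}"

definition Cplus :: "quat \<Rightarrow> quat set" where
  "Cplus I = {qreal x + y *\<^sub>R I | x y. y > 0}"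

definition axially_symmetric :: "quat set \<Rightarrow> bool" where
  "axially_symmetric E \<longleftrightarrow>
     (\<forall>x y I J. I \<in> qS \<longrightarrow> J \<in> qS \<longrightarrow> qreal x + y *\<^sub>R I \<in> E \<longrightarrow> qreal x + y *\<^sub>R J \<in> E)"

definition axially_symmetric_domain :: "quat set \<Rightarrow> bool" where
  "axially_symmetric_domain \<Omega> \<longleftrightarrow> open \<Omega> \<and> connected \<Omega> \<and> axially_symmetric \<Omega>"

definition Iu :: "quat \<Rightarrow> quat" where
  "Iu q = (THE I. I \<in> qS \<and> q \<in> Cplus I)"

definition as_covering :: "quat set set \<Rightarrow> quat set \<Rightarrow> bool" where
  "as_covering \<U> \<Omega> \<longleftrightarrow> (\<forall>U\<in>\<U>. open U \<and> axially_symmetric U \<and> U \<subseteq> \<Omega>) \<and> \<Union>\<U> = \<Omega>"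

definition inter_of :: "quat set list \<Rightarrow> quat set" where
  "inter_of L = \<Inter>(set L)"

definition multi_idx :: "quat set set \<Rightarrow> nat \<Rightarrow> quat set list set" where
  "multi_idx \<U> m = {L. set L \<subseteq> \<U> \<and> length L = Suc m}"

definition IZ_cochain :: "quat set set \<Rightarrow> nat \<Rightarrow> (quat set list \<Rightarrow> quat \<Rightarrow> quat) \<Rightarrow> bool" where
  "IZ_cochain \<U> m c \<longleftrightarrow>
     (\<forall>L\<in>multi_idx \<U> m.
        continuous_on (inter_of L) (c L) \<and>
        (\<exists>n::int. \<forall>q\<in>inter_of L. c L q = of_int n *\<^sub>R Iu q))"

definition del_at :: "nat \<Rightarrow> 'a list \<Rightarrow> 'a list" where
  "del_at i L = take i L @ drop (Suc i) L"

definition cech_delta :: "(quat set list \<Rightarrow> quat \<Rightarrow> quat) \<Rightarrow> quat set list \<Rightarrow> quat \<Rightarrow> quat" where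
  "cech_delta c L q = (\<Sum>i<length L. ((-1::real) ^ i) *\<^sub>R c (del_at i L) q)"

definition IZ_cocycle :: "quat set set \<Rightarrow> nat \<Rightarrow> (quat set list \<Rightarrow> quat \<Rightarrow> quat) \<Rightarrow> bool" where
  "IZ_cocycle \<U> m c \<longleftrightarrow> IZ_cochain \<U> m c \<and>
     (\<forall>L\<in>multi_idx \<U> (Suc m). \<forall>q\<in>inter_of L. cech_delta c L q = 0)"

definition IZ_coboundary :: "quat set set \<Rightarrow> nat \<Rightarrow> (quat set list \<Rightarrow> quat \<Rightarrow> quat) \<Rightarrow> bool" where
  "IZ_coboundary \<U> m c \<longleftrightarrow>
     (\<exists>b. IZ_cochain \<U> (m - 1) b \<and>
          (\<forall>L\<in>multi_idx \<U> m. \<forall>q\<in>inter_of L. c L q = cech_delta b L q))"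

definition refines_via :: "quat set set \<Rightarrow> quat set set \<Rightarrow> (quat set \<Rightarrow> quat set) \<Rightarrow> bool" where
  "refines_via \<V> \<U> \<tau> \<longleftrightarrow> (\<forall>V\<in>\<V>. \<tau> V \<in> \<U> \<and> V \<subseteq> \<tau> V)"

definition pullback :: "(quat set \<Rightarrow> quat set) \<Rightarrow> (quat set list \<Rightarrow> quat \<Rightarrow> quat) \<Rightarrow> quat set list \<Rightarrow> quat \<Rightarrow> quat" where
  "pullback \<tau> c L = c (map \<tau> L)"

text \<open>H^n(\<Omega>, IZ) = 0 (direct limit over axially symmetric open coverings): every n-cocycle
  on every axially symmetric open covering becomes a coboundary on some refinement.\<close>
definition IZ_cohomology_vanishes :: "quat set \<Rightarrow> nat \<Rightarrow> bool" where
  "IZ_cohomology_vanishes \<Omega> n \<longleftrightarrow>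
     (\<forall>\<U> c. as_covering \<U> \<Omega> \<longrightarrow> IZ_cocycle \<U> n c \<longrightarrow>
        (\<exists>\<V> \<tau>. as_covering \<V> \<Omega> \<and> refines_via \<V> \<U> \<tau> \<and> IZ_coboundary \<V> n (pullback \<tau> c)))"

end

(* In the coordinates (Re q, |Im q|) axially symmetric open sets become relatively open subsets of the
   closed upper half plane, and cochains with coefficients in I Z become integer cochains on the
   nerve of a covering that vanish on intersections meeting the real line.  An open subset D of the
   half plane is exhausted by compact cores and tiled, shell by shell, by dyadic squares of decreasing
   size; slightly enlarged, these squares refine any given covering.  By Helly's theorem for boxes
   the nerve consists of the cliques of the touching relation.  Start from the squares on the real
   line, where the zero cochain is a primitive, and add the other squares one at a time, so that each
   square has an edge neighbour which is not covered by earlier squares: since D is bounded, every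
   square has a route to the complement of D, and the squares of a shell are added in order of
   decreasing length of such routes.  The earlier squares touching a new square Q then cut the
   boundary of Q, opened at the free edge, in intervals.  So the link of Q has no cohomology in
   positive degrees, and Mayer-Vietoris extends primitives of cocycles of degree at least 2. *)

theory Submission
  imports Defs
begin

section \<open>Cochains on clique complexes\<close>

definition cob :: "('a list \<Rightarrow> int) \<Rightarrow> 'a list \<Rightarrow> int" where
  "cob f M = (\<Sum>i<length M. (-1) ^ i * f (del_at i M))"

definition cliques :: "'a set \<Rightarrow> ('a \<Rightarrow> 'a \<Rightarrow> bool) \<Rightarrow> 'a list set" where
  "cliques X r = {M. set M \<subseteq> X \<and> (\<forall>u\<in>set M. \<forall>v\<in>set M. r u v)}"

text \<open>With lists of length \<open>l\<close> in degree \<open>l - 1\<close>, this is the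
  vanishing of reduced cohomology of the clique complex in all degrees from \<open>m - 1\<close>
  on.\<close>

definition acyclic_from :: "nat \<Rightarrow> 'a set \<Rightarrow> ('a \<Rightarrow> 'a \<Rightarrow> bool) \<Rightarrow> bool" where
  "acyclic_from m X r \<longleftrightarrow> (\<forall>l\<ge>m. \<forall>c. (\<forall>M\<in>cliques X r. length M = Suc l \<longrightarrow> cob c M = 0) \<longrightarrow>
     (\<exists>b. \<forall>M\<in>cliques X r. length M = l \<longrightarrow> c M = cob b M))"

section \<open>Faces of lists and the coboundary operator\<close>

lemma del_at_Cons_0 [simp]: "del_at 0 (x # M) = M"
  by (simp add: del_at_def)

lemma del_at_Cons_Suc [simp]: "del_at (Suc i) (x # M) = x # del_at i M"
  by (simp add: del_at_def)

lemma set_del_at_subset: "set (del_at i M) \<subseteq> set M"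
  using set_take_subset[of i M] set_drop_subset[of "Suc i" M] by (auto simp: del_at_def)

lemma length_del_at: "i < length M \<Longrightarrow> length (del_at i M) = length M - 1"
  by (simp add: del_at_def)

lemma map_del_at: "map f (del_at i M) = del_at i (map f M)"
  by (simp add: del_at_def take_map drop_map)

lemma cob_Nil [simp]: "cob f [] = 0"
  by (simp add: cob_def)

text \<open>All faces but the first keep the head \<open>x\<close>, with signs shifted by one. For a
  cocycle this is the contraction of a cone with apex \<open>x\<close>.\<close>

lemma cob_Cons: "cob f (x # M) = f M - cob (\<lambda>N. f (x # N)) M"
  unfolding cob_def by (simp add: sum.lessThan_Suc_shift sum_negf del: sum.lessThan_Suc)

lemma cob_diff: "cob (\<lambda>N. f N - g N) M = cob f M - cob g M"
  by (simp add: cob_def right_diff_distrib sum_subtractf)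

lemma cob_add: "cob (\<lambda>N. f N + g N) M = cob f M + cob g M"
  by (simp add: cob_def distrib_left sum.distrib)

lemma cob_cong:
  assumes "\<And>N. set N \<subseteq> set M \<Longrightarrow> Suc (length N) = length M \<Longrightarrow> f N = g N"
  shows "cob f M = cob g M"
  unfolding cob_def
proof (rule sum.cong)
  fix i assume "i \<in> {..<length M}"
  then have "f (del_at i M) = g (del_at i M)"
    by (intro assms) (auto simp: length_del_at dest: set_del_at_subset[THEN subsetD])
  then show "(- 1) ^ i * f (del_at i M) = (- 1) ^ i * g (del_at i M)" by simp
qed simp

lemma cob_cob: "cob (cob f) M = 0"
proof (induction M arbitrary: f)
  case (Cons x M)
  show ?case
    by (simp add: cob_Cons cob_diff Cons.IH)
qed simp

lemma cliques_mono: "X \<subseteq> Y \<Longrightarrow> cliques X r \<subseteq> cliques Y r"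
  by (auto simp: cliques_def)

lemma cliques_subset: "M \<in> cliques X r \<Longrightarrow> set N \<subseteq> set M \<Longrightarrow> N \<in> cliques X r"
  unfolding cliques_def by blast

text \<open>The complex is a simplex, hence a cone: the cocycle equation on \<open>a # M\<close>
  says that prefixing a fixed vertex \<open>a\<close> yields a primitive.\<close>

lemma acyclic_from_full:
  assumes "\<And>u v. u \<in> X \<Longrightarrow> v \<in> X \<Longrightarrow> r u v"
  shows "acyclic_from 1 X r"
  unfolding acyclic_from_def
proof (intro allI impI)
  fix l c
  assume l: "1 \<le> l" and c: "\<forall>M\<in>cliques X r. length M = Suc l \<longrightarrow> cob c M = 0"
  have cl: "M \<in> cliques X r \<longleftrightarrow> set M \<subseteq> X" for M
    using assms by (auto simp: cliques_def)
  show "\<exists>b. \<forall>M\<in>cliques X r. length M = l \<longrightarrow> c M = cob b M"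
  proof (cases "X = {}")
    case True
    then show ?thesis using l by (intro exI[of _ c]) (auto simp: cliques_def)
  next
    case False
    then obtain a where "a \<in> X" by blast
    then have "c M = cob (\<lambda>N. c (a # N)) M" if "set M \<subseteq> X" "length M = l" for M
      using c[rule_format, of "a # M"] that by (simp add: cl cob_Cons)
    then show ?thesis by (auto simp: cl)
  qed
qed

lemma finite_total_greatest:
  assumes "finite S" "S \<noteq> {}" "trans R" "total_on S R"
  shows "\<exists>v\<in>S. \<forall>u\<in>S. u = v \<or> (u, v) \<in> R"
  using assms(1,2,4)
proof (induction rule: finite_ne_induct)
  case (insert x F)
  then obtain v where v: "v \<in> F" "\<forall>u\<in>F. u = v \<or> (u, v) \<in> R"
    by (meson subset_insertI total_on_subset)
  have "(x, v) \<in> R \<or> (v, x) \<in> R"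
    using insert.prems insert.hyps v(1) by (metis insertCI total_on_def)
  then show ?case
    using v \<open>trans R\<close> by (metis insert_iff transD)
qed simp

text \<open>Mayer--Vietoris, one vertex \<open>v\<close> at a time: on the cone over the earlier link the primitive
  is \<open>\<lambda>N. c (v # N)\<close>, and its difference to the primitive already found is a cocycle on the link,
  hence a coboundary there; extending that primitive by zero makes the two agree on the link.\<close>

lemma attach_vertices:
  fixes R :: "('a \<times> 'a) set"
  assumes R: "wf R" "trans R" "total_on (X - X0) R"
    and r: "\<And>u v. r u v \<Longrightarrow> r v u"
    and r_refl: "\<And>v. v \<in> X \<Longrightarrow> r v v"
    and link: "\<And>v. v \<in> X - X0 \<Longrightarrow>
          acyclic_from m {u \<in> X. u \<noteq> v \<and> r u v \<and> (u \<in> X0 \<or> (u, v) \<in> R)} r"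
    and l: "Suc m \<le> l"
    and c: "\<And>M. M \<in> cliques X r \<Longrightarrow> length M = Suc l \<Longrightarrow> cob c M = 0"
    and c0: "\<And>M. M \<in> cliques X r \<Longrightarrow> set M \<subseteq> X0 \<Longrightarrow> length M = l \<Longrightarrow> c M = 0"
  shows "\<exists>b. (\<forall>M\<in>cliques X r. length M = l \<longrightarrow> c M = cob b M) \<and> (\<forall>M. set M \<subseteq> X0 \<longrightarrow> b M = 0)"
proof -
  \<comment> \<open>\<open>top M\<close> is the vertex of \<open>M\<close> outside \<open>X0\<close>
    that is attached last. \<open>B f\<close> glues partial primitives: \<open>f v\<close> on lists
    with last vertex \<open>v\<close>, zero on lists inside \<open>X0\<close>.\<close>
  define top where "top M = (THE v. v \<in> set M - X0 \<and> (\<forall>u\<in>set M - X0. u = v \<or> (u, v) \<in> R))" for M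
  define B where "B f M = (if set M \<subseteq> X0 then 0 else f (top M) M)" for f :: "'a \<Rightarrow> 'a list \<Rightarrow> int" and M
  have asym: "(u, v) \<notin> R" if "(v, u) \<in> R" for u v
    using R(1) that by (meson wf_asym)
  have top_eq: "top M = v" if "v \<in> set M - X0" "\<forall>u\<in>set M - X0. u = v \<or> (u, v) \<in> R" for M v
    unfolding top_def
  proof (rule the_equality)
    show "v \<in> set M - X0 \<and> (\<forall>u\<in>set M - X0. u = v \<or> (u, v) \<in> R)" using that by blast
  next
    fix w assume "w \<in> set M - X0 \<and> (\<forall>u\<in>set M - X0. u = w \<or> (u, w) \<in> R)"
    then show "w = v" using that asym[of v w] by metis
  qed
  have top: "top M \<in> set M - X0 \<and> (\<forall>u\<in>set M - X0. u = top M \<or> (u, top M) \<in> R)"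
    if M: "M \<in> cliques X r" "\<not> set M \<subseteq> X0" for M
  proof -
    have "total_on (set M - X0) R"
      using M(1) by (intro total_on_subset[OF R(3)]) (auto simp: cliques_def)
    then obtain v where "v \<in> set M - X0" "\<forall>u\<in>set M - X0. u = v \<or> (u, v) \<in> R"
      using finite_total_greatest[of "set M - X0" R] M(2) R(2) by blast
    then show ?thesis using top_eq by metis
  qed
  have B_face: "f (top M) N = B f N"
    if "M \<in> cliques X r" "\<not> set M \<subseteq> X0" "set N \<subseteq> set M" "top M \<in> set N" for f M N
  proof -
    have "top N = top M"
      using top[OF that(1,2)] that(3,4) by (intro top_eq) blast+
    moreover have "\<not> set N \<subseteq> X0" using top[OF that(1,2)] that(4) by blast
    ultimately show ?thesis by (simp add: B_def)
  qed
  \<comment> \<open>The demand on stage \<open>v\<close>: faces through \<open>v\<close> take their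
    values from \<open>g\<close>, all other faces from the primitive glued so far.\<close>
  define P where "P f v g \<longleftrightarrow> (v \<in> X - X0 \<longrightarrow> (\<forall>M\<in>cliques X r. length M = l \<longrightarrow> v \<in> set M \<longrightarrow>
      (\<forall>u\<in>set M - X0. u = v \<or> (u, v) \<in> R) \<longrightarrow> c M = cob (\<lambda>N. if v \<in> set N then g N else B f N) M))"
    for f :: "'a \<Rightarrow> 'a list \<Rightarrow> int" and v and g :: "'a list \<Rightarrow> int"
  have "\<exists>f. \<forall>v. P f v (f v)"
  proof (rule dependent_wf_choice[OF R(1)])
    fix f g :: "'a \<Rightarrow> 'a list \<Rightarrow> int" and v h
    assume fg: "\<And>z. (z, v) \<in> R \<Longrightarrow> f z = g z"
    \<comment> \<open>Stage \<open>v\<close> looks only at earlier values: a face omitting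
      \<open>v\<close> lies in \<open>X0\<close> or has its last vertex below
      \<open>v\<close>.\<close>
    have "cob (\<lambda>N. if v \<in> set N then h N else B f N) M = cob (\<lambda>N. if v \<in> set N then h N else B g N) M"
      if M: "M \<in> cliques X r" "\<forall>u\<in>set M - X0. u = v \<or> (u, v) \<in> R" for M
    proof (rule cob_cong)
      fix N assume N: "set N \<subseteq> set M"
      have "B f N = B g N" if "v \<notin> set N"
      proof (cases "set N \<subseteq> X0")
        case False
        have "(top N, v) \<in> R"
          using top[OF cliques_subset[OF M(1) N] False] that M(2) N
          by (metis DiffD1 DiffD2 DiffI subsetD)
        then show ?thesis by (simp add: B_def fg)
      qed (simp add: B_def)
      then show "(if v \<in> set N then h N else B f N) = (if v \<in> set N then h N else B g N)" by simp
    qed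
    then show "P f v h = P g v h" unfolding P_def by (smt (verit))
  next
    fix v f
    assume IH: "\<And>y. (y, v) \<in> R \<Longrightarrow> P f y (f y)"
    show "\<exists>g. P f v g"
    proof (cases "v \<in> X - X0")
      case v: True
      define Y where "Y = {u \<in> X. u \<noteq> v \<and> r u v \<and> (u \<in> X0 \<or> (u, v) \<in> R)}"
      have YX: "Y \<subseteq> X" "v \<notin> Y" by (auto simp: Y_def)
      \<comment> \<open>Cliques may repeat vertices, so \<open>M\<close> is allowed to contain
        \<open>v\<close> already.\<close>
      have cone: "v # M \<in> cliques X r" if "M \<in> cliques X r" "set M \<subseteq> insert v Y" for M
        using that v r r_refl by (fastforce simp: cliques_def Y_def)
      have cone_eq: "c M = cob (\<lambda>N. c (v # N)) M"
        if "M \<in> cliques X r" "set M \<subseteq> insert v Y" "length M = l" for M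
        using c[OF cone[OF that(1,2)]] that(3) by (simp add: cob_Cons)
      have old: "c M = cob (B f) M" if M: "M \<in> cliques X r" "set M \<subseteq> Y" "length M = l" for M
      proof (cases "set M \<subseteq> X0")
        case True
        have "cob (B f) M = cob (\<lambda>_. 0) M"
          using True by (intro cob_cong) (auto simp: B_def)
        then show ?thesis using c0[OF M(1) True M(3)] by (simp add: cob_def)
      next
        case False
        let ?y = "top M"
        note t = top[OF M(1) False]
        then have "P f ?y (f ?y)" using M(2) by (intro IH) (auto simp: Y_def)
        moreover have "?y \<in> X - X0" using t M(2) YX by auto
        ultimately have "c M = cob (\<lambda>N. if ?y \<in> set N then f ?y N else B f N) M"
          unfolding P_def using t M by blast
        also have "\<dots> = cob (B f) M"
        proof (rule cob_cong)
          fix N assume N: "set N \<subseteq> set M"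
          have "f ?y N = B f N" if "?y \<in> set N"
            using B_face[OF M(1) False N that] .
          then show "(if ?y \<in> set N then f ?y N else B f N) = B f N" by simp
        qed
        finally show ?thesis .
      qed
      have diff: "cob (\<lambda>N. B f N - c (v # N)) M = 0" if "M \<in> cliques Y r" "length M = l" for M
      proof -
        have "M \<in> cliques X r" "set M \<subseteq> Y"
          using that(1) cliques_mono[OF YX(1)] by (auto simp: cliques_def)
        then show ?thesis using old[of M] cone_eq[of M] that(2) by (auto simp: cob_diff)
      qed
      \<comment> \<open>Faces of lists of length \<open>l\<close> have length \<open>l'\<close>, so
        the link is used one degree lower; hence the assumption
        \<open>Suc m \<le> l\<close>.\<close>
      obtain l' where l': "l = Suc l'" "m \<le> l'" using l by (cases l) auto
      have "acyclic_from m Y r" using link[OF v] by (simp add: Y_def)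
      then have "\<exists>b. \<forall>M\<in>cliques Y r. length M = l' \<longrightarrow> B f M - c (v # M) = cob b M"
        unfolding acyclic_from_def
        by (rule allE[where x = l'], elim impE allE[where x = "\<lambda>N. B f N - c (v # N)"])
          (use diff l' in auto)
      then obtain \<beta> where \<beta>: "\<And>M. M \<in> cliques Y r \<Longrightarrow> length M = l' \<Longrightarrow> B f M - c (v # M) = cob \<beta> M"
        by blast
      \<comment> \<open>Extension by zero off the link. By \<open>cob_cob\<close>, adding
        \<open>cob \<beta>'\<close> keeps \<open>g\<close> a primitive on the cone, while on link
        lists of length \<open>l'\<close> it turns \<open>c (v # N)\<close> into
        \<open>B f N\<close>.\<close>
      define \<beta>' where "\<beta>' N = (if set N \<subseteq> Y then \<beta> N else 0)" for N
      define g where "g M = c (v # M) + cob \<beta>' M" for M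
      have g_old: "g N = B f N" if "N \<in> cliques Y r" "length N = l'" for N
      proof -
        have "cob \<beta>' N = cob \<beta> N"
          using that(1) by (intro cob_cong) (auto simp: \<beta>'_def cliques_def)
        then show ?thesis using \<beta>[OF that] by (simp add: g_def)
      qed
      have "P f v g"
        unfolding P_def
      proof (intro impI ballI)
        fix M assume M: "M \<in> cliques X r" "length M = l" "v \<in> set M"
          "\<forall>u\<in>set M - X0. u = v \<or> (u, v) \<in> R"
        have MY: "set M \<subseteq> insert v Y" using M by (auto simp: Y_def cliques_def)
        have "cob (\<lambda>N. if v \<in> set N then g N else B f N) M = cob g M"
        proof (rule cob_cong)
          fix N assume N: "set N \<subseteq> set M" "Suc (length N) = length M"
          have "g N = B f N" if "v \<notin> set N"
            using that N M MY l' by (intro g_old) (auto simp: cliques_def subset_iff)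
          then show "(if v \<in> set N then g N else B f N) = g N" by simp
        qed
        also have "\<dots> = c M"
          using cone_eq[OF M(1) MY M(2)] unfolding g_def by (simp add: cob_add cob_cob)
        finally show "c M = cob (\<lambda>N. if v \<in> set N then g N else B f N) M" by simp
      qed
      then show ?thesis by blast
    qed (unfold P_def, blast)
  qed
  then obtain f where f: "\<And>v. P f v (f v)" by blast
  have "c M = cob (B f) M" if M: "M \<in> cliques X r" "length M = l" for M
  proof (cases "set M \<subseteq> X0")
    case True
    have "cob (B f) M = cob (\<lambda>_. 0) M"
      using True by (intro cob_cong) (auto simp: B_def)
    then show ?thesis using c0[OF M(1) True M(2)] by (simp add: cob_def)
  next
    case False
    let ?y = "top M"
    note t = top[OF M(1) False]
    then have "?y \<in> X - X0" using M(1) by (auto simp: cliques_def)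
    then have "c M = cob (\<lambda>N. if ?y \<in> set N then f ?y N else B f N) M"
      using f[of ?y] t M unfolding P_def by blast
    also have "\<dots> = cob (B f) M"
    proof (rule cob_cong)
      fix N assume N: "set N \<subseteq> set M"
      have "f ?y N = B f N" if "?y \<in> set N"
        using B_face[OF M(1) False N that] .
      then show "(if ?y \<in> set N then f ?y N else B f N) = B f N" by simp
    qed
    finally show ?thesis .
  qed
  then show ?thesis by (intro exI[of _ "B f"]) (auto simp: B_def)
qed

text \<open>Intervals are attached in the order of their left ends. All earlier neighbours of
  \<open>v\<close> contain the point \<open>lo v\<close>, so the link of \<open>v\<close> is a
  simplex.\<close>

lemma acyclic_from_intervals:
  fixes lo hi :: "'a::countable \<Rightarrow> nat"
  assumes r: "\<And>u v. u \<in> X \<Longrightarrow> v \<in> X \<Longrightarrow> r u v \<longleftrightarrow> lo u \<le> hi v \<and> lo v \<le> hi u"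
    and le: "\<And>u. u \<in> X \<Longrightarrow> lo u \<le> hi u"
  shows "acyclic_from 2 X r"
  unfolding acyclic_from_def
proof (intro allI impI)
  fix l :: nat and c
  assume l: "2 \<le> l" and c: "\<forall>M\<in>cliques X r. length M = Suc l \<longrightarrow> cob c M = 0"
  \<comment> \<open>\<open>q\<close> cuts \<open>r\<close> down to \<open>X\<close>, where it is
    known to be symmetric; in \<open>R\<close> the encoding breaks ties between equal left
    ends.\<close>
  define q where "q u v \<longleftrightarrow> u \<in> X \<and> v \<in> X \<and> r u v" for u v
  define R where "R = inv_image (less_than <*lex*> less_than) (\<lambda>u::'a. (lo u, to_nat u))"
  have eq: "cliques X r = cliques X q" by (auto simp: cliques_def q_def)
  have wf: "wf R" unfolding R_def by (intro wf_inv_image wf_lex_prod wf_less_than)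
  have tr: "trans R" unfolding R_def by (intro trans_inv_image) auto
  have tot: "total_on (X - {}) R"
    by (auto simp: R_def total_on_def) (metis injD inj_to_nat linorder_neqE_nat)
  have link: "acyclic_from 1 {u \<in> X. u \<noteq> v \<and> q u v \<and> (u \<in> {} \<or> (u, v) \<in> R)} q" if "v \<in> X - {}" for v
  proof (rule acyclic_from_full)
    fix u w
    assume "u \<in> {u \<in> X. u \<noteq> v \<and> q u v \<and> (u \<in> {} \<or> (u, v) \<in> R)}"
      "w \<in> {u \<in> X. u \<noteq> v \<and> q u v \<and> (u \<in> {} \<or> (u, v) \<in> R)}"
    then show "q u w" using that by (auto simp: q_def r R_def)
  qed
  have "\<exists>b. (\<forall>M\<in>cliques X q. length M = l \<longrightarrow> c M = cob b M) \<and> (\<forall>M. set M \<subseteq> {} \<longrightarrow> b M = 0)"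
  proof (rule attach_vertices[OF wf tr tot _ _ link])
    show "q v u" if "q u v" for u v using that by (auto simp: q_def r)
    show "q v v" if "v \<in> X" for v using that by (auto simp: q_def r le)
    show "cob c M = 0" if "M \<in> cliques X q" "length M = Suc l" for M using that c by (simp add: eq)
  qed (use l in auto)
  then show "\<exists>b. \<forall>M\<in>cliques X r. length M = l \<longrightarrow> c M = cob b M"
    by (auto simp: eq)
qed

text \<open>Two boxes and the unit square that meet pairwise have a common lattice point, so boxes
  touch iff they share a corner of the square. A box with both top corners would cover the square or
  the one above it, so each box holds consecutive corners on the path left by removing the top
  edge.\<close>

lemma acyclic_from_link_top:
  fixes xl xh yl yh :: "'a::countable \<Rightarrow> int"
  assumes r: "\<And>u v. u \<in> Y \<Longrightarrow> v \<in> Y \<Longrightarrow>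
      r u v \<longleftrightarrow> xl u \<le> xh v \<and> xl v \<le> xh u \<and> yl u \<le> yh v \<and> yl v \<le> yh u"
    and nd: "\<And>u. u \<in> Y \<Longrightarrow> xl u < xh u \<and> yl u < yh u"
    and touch: "\<And>u. u \<in> Y \<Longrightarrow> xl u \<le> i + 1 \<and> i \<le> xh u \<and> yl u \<le> k + 1 \<and> k \<le> yh u"
    and self: "\<And>u. u \<in> Y \<Longrightarrow> \<not> (xl u \<le> i \<and> i + 1 \<le> xh u \<and> yl u \<le> k \<and> k + 1 \<le> yh u)"
    and free: "\<And>u. u \<in> Y \<Longrightarrow> \<not> (xl u \<le> i \<and> i + 1 \<le> xh u \<and> yl u \<le> k + 1 \<and> k + 2 \<le> yh u)"
  shows "acyclic_from 2 Y r"
proof -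
  \<comment> \<open>The first and last corner of the unit square \<open>[i, i + 1] \<times> [k, k + 1]\<close> lying in \<open>u\<close>, numbered
    from 0 to 3 downwards from the top left corner and round to the top right one.\<close>
  define lo :: "'a \<Rightarrow> nat" where "lo u =
    (if xl u \<le> i then (if k + 1 \<le> yh u then 0 else 1) else (if yl u \<le> k then 2 else 3))" for u
  define hi :: "'a \<Rightarrow> nat" where "hi u =
    (if i + 1 \<le> xh u then (if k + 1 \<le> yh u then 3 else 2) else (if yl u \<le> k then 1 else 0))" for u
  have "r u v \<longleftrightarrow> lo u \<le> hi v \<and> lo v \<le> hi u" if "u \<in> Y" "v \<in> Y" for u v
    using nd[OF that(1)] nd[OF that(2)] touch[OF that(1)] touch[OF that(2)]
      self[OF that(1)] self[OF that(2)] free[OF that(1)] free[OF that(2)]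
    unfolding r[OF that] lo_def hi_def by (auto split: if_split)
  moreover have "lo u \<le> hi u" if "u \<in> Y" for u
    using nd[OF that] touch[OF that] self[OF that] free[OF that]
    unfolding lo_def hi_def by (auto split: if_split)
  ultimately show ?thesis
    by (rule acyclic_from_intervals)
qed

text \<open>Reflections and the exchange of the axes move the free neighbour to the top; reflecting
  sends the row \<open>k\<close> to the row \<open>- k - 1\<close>.\<close>

lemma acyclic_from_link:
  fixes xl xh yl yh :: "'a::countable \<Rightarrow> int"
  assumes r: "\<And>u v. u \<in> Y \<Longrightarrow> v \<in> Y \<Longrightarrow>
      r u v \<longleftrightarrow> xl u \<le> xh v \<and> xl v \<le> xh u \<and> yl u \<le> yh v \<and> yl v \<le> yh u"
    and nd: "\<And>u. u \<in> Y \<Longrightarrow> xl u < xh u \<and> yl u < yh u"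
    and touch: "\<And>u. u \<in> Y \<Longrightarrow> xl u \<le> i + 1 \<and> i \<le> xh u \<and> yl u \<le> k + 1 \<and> k \<le> yh u"
    and self: "\<And>u. u \<in> Y \<Longrightarrow> \<not> (xl u \<le> i \<and> i + 1 \<le> xh u \<and> yl u \<le> k \<and> k + 1 \<le> yh u)"
    and free: "\<And>u. u \<in> Y \<Longrightarrow> \<not> (xl u \<le> i' \<and> i' + 1 \<le> xh u \<and> yl u \<le> k' \<and> k' + 1 \<le> yh u)"
    and nb: "\<bar>i' - i\<bar> + \<bar>k' - k\<bar> = 1"
  shows "acyclic_from 2 Y r"
proof -
  consider "i' = i" "k' = k + 1" | "i' = i" "k' = k - 1" | "i' = i + 1" "k' = k" | "i' = i - 1" "k' = k"
    using nb by linarith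
  then show ?thesis
  proof cases
    case 1
    show ?thesis
    proof (rule acyclic_from_link_top[OF r nd touch self])
      show "\<not> (xl u \<le> i \<and> i + 1 \<le> xh u \<and> yl u \<le> k + 1 \<and> k + 2 \<le> yh u)" if "u \<in> Y" for u
        using free[OF that] 1 by auto
    qed
  next
    case 2
    show ?thesis
    proof (rule acyclic_from_link_top[where xl = xl and xh = xh and yl = "\<lambda>u. - yh u"
          and yh = "\<lambda>u. - yl u" and i = i and k = "- k - 1"])
      show "r u v \<longleftrightarrow> xl u \<le> xh v \<and> xl v \<le> xh u \<and> - yh u \<le> - yl v \<and> - yh v \<le> - yl u"
        if "u \<in> Y" "v \<in> Y" for u v using r[OF that] by auto
      fix u assume u: "u \<in> Y"
      show "xl u < xh u \<and> - yh u < - yl u" using nd[OF u] by simp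
      show "xl u \<le> i + 1 \<and> i \<le> xh u \<and> - yh u \<le> - k - 1 + 1 \<and> - k - 1 \<le> - yl u"
        using touch[OF u] by auto
      show "\<not> (xl u \<le> i \<and> i + 1 \<le> xh u \<and> - yh u \<le> - k - 1 \<and> - k - 1 + 1 \<le> - yl u)"
        using self[OF u] by auto
      show "\<not> (xl u \<le> i \<and> i + 1 \<le> xh u \<and> - yh u \<le> - k - 1 + 1 \<and> - k - 1 + 2 \<le> - yl u)"
        using free[OF u] 2 by auto
    qed
  next
    case 3
    show ?thesis
    proof (rule acyclic_from_link_top[where xl = yl and xh = yh and yl = xl and yh = xh and i = k and k = i])
      show "r u v \<longleftrightarrow> yl u \<le> yh v \<and> yl v \<le> yh u \<and> xl u \<le> xh v \<and> xl v \<le> xh u"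
        if "u \<in> Y" "v \<in> Y" for u v using r[OF that] by auto
      fix u assume u: "u \<in> Y"
      show "yl u < yh u \<and> xl u < xh u" using nd[OF u] by simp
      show "yl u \<le> k + 1 \<and> k \<le> yh u \<and> xl u \<le> i + 1 \<and> i \<le> xh u"
        using touch[OF u] by auto
      show "\<not> (yl u \<le> k \<and> k + 1 \<le> yh u \<and> xl u \<le> i \<and> i + 1 \<le> xh u)"
        using self[OF u] by auto
      show "\<not> (yl u \<le> k \<and> k + 1 \<le> yh u \<and> xl u \<le> i + 1 \<and> i + 2 \<le> xh u)"
        using free[OF u] 3 by auto
    qed
  next
    case 4
    show ?thesis
    proof (rule acyclic_from_link_top[where xl = yl and xh = yh and yl = "\<lambda>u. - xh u"
          and yh = "\<lambda>u. - xl u" and i = k and k = "- i - 1"])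
      show "r u v \<longleftrightarrow> yl u \<le> yh v \<and> yl v \<le> yh u \<and> - xh u \<le> - xl v \<and> - xh v \<le> - xl u"
        if "u \<in> Y" "v \<in> Y" for u v using r[OF that] by auto
      fix u assume u: "u \<in> Y"
      show "yl u < yh u \<and> - xh u < - xl u" using nd[OF u] by simp
      show "yl u \<le> k + 1 \<and> k \<le> yh u \<and> - xh u \<le> - i - 1 + 1 \<and> - i - 1 \<le> - xl u"
        using touch[OF u] by auto
      show "\<not> (yl u \<le> k \<and> k + 1 \<le> yh u \<and> - xh u \<le> - i - 1 \<and> - i - 1 + 1 \<le> - xl u)"
        using self[OF u] by auto
      show "\<not> (yl u \<le> k \<and> k + 1 \<le> yh u \<and> - xh u \<le> - i - 1 + 1 \<and> - i - 1 + 2 \<le> - xl u)"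
        using free[OF u] 4 by auto
    qed
  qed
qed

section \<open>Tilings of planar open sets\<close>

text \<open>An inner parallel set of \<open>D\<close>, taken in the maximum norm because its balls
  are squares.\<close>

definition core :: "(real \<times> real) set \<Rightarrow> nat \<Rightarrow> (real \<times> real) set" where
  "core D j = {z. \<forall>w. w \<notin> D \<longrightarrow> 1 / 2 ^ j \<le> max \<bar>fst z - fst w\<bar> \<bar>snd z - snd w\<bar>}"

lemma core_subset: "core D j \<subseteq> D"
proof
  fix z assume z: "z \<in> core D j"
  show "z \<in> D"
  proof (rule ccontr)
    assume "z \<notin> D"
    then have "1 / 2 ^ j \<le> max \<bar>fst z - fst z\<bar> \<bar>snd z - snd z\<bar>"
      using z unfolding core_def by blast
    moreover have "0 < (1 / 2 ^ j :: real)" by simp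
    ultimately show False by (simp only: diff_self abs_zero max.idem)
  qed
qed

lemma core_mono: "i \<le> j \<Longrightarrow> core D i \<subseteq> core D j"
proof -
  assume "i \<le> j"
  then have "1 / 2 ^ j \<le> (1 / 2 ^ i :: real)" by (simp add: field_simps)
  then show ?thesis unfolding core_def by force
qed

lemma compact_core:
  assumes "bounded D" shows "compact (core D j)"
proof -
  have "core D j = (\<Inter>w\<in>-D. {z. 1 / 2 ^ j \<le> max \<bar>fst z - fst w\<bar> \<bar>snd z - snd w\<bar>})"
    unfolding core_def by blast
  also have "closed \<dots>"
    by (intro closed_INT ballI closed_Collect_le continuous_intros)
  finally show ?thesis
    using bounded_subset[OF assms core_subset] by (simp add: compact_eq_bounded_closed)
qed

text \<open>Shell \<open>j\<close> uses the grid of mesh \<open>1 / 2 ^ a j\<close>. Strict growth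
  nests the grids, and \<open>less_a\<close> keeps the mesh at most half the margin of
  \<open>core D j\<close>. By \<open>sym_D\<close> the half plane is doubled along the real
  line.\<close>

locale tiling =
  fixes D :: "(real \<times> real) set" and a :: "nat \<Rightarrow> nat"
  assumes bounded_D: "bounded D"
    and sym_D: "\<And>x y. (x, - y) \<in> D \<longleftrightarrow> (x, y) \<in> D"
    and strict_mono_a: "strict_mono a"
    and less_a: "\<And>j. j < a j"
begin

definition lo :: "nat \<Rightarrow> int \<Rightarrow> real" where
  "lo j i = real_of_int i / 2 ^ a j"

definition sqr :: "nat \<Rightarrow> int \<Rightarrow> int \<Rightarrow> (real \<times> real) set" where
  "sqr j i k = {lo j i..lo j (i + 1)} \<times> {lo j k..lo j (k + 1)}"

text \<open>Index of the coarser interval at level \<open>j'\<close> containing the \<open>i\<close>-th interval of level \<open>j\<close>;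
  meaningful for \<open>j' \<le> j\<close> only.\<close>

definition anc :: "nat \<Rightarrow> nat \<Rightarrow> int \<Rightarrow> int" where
  "anc j' j i = i div 2 ^ (a j - a j')"

definition free :: "nat \<Rightarrow> int \<Rightarrow> int \<Rightarrow> bool" where
  "free j i k \<longleftrightarrow> (\<forall>j'<j. \<not> sqr j' (anc j' j i) (anc j' j k) \<subseteq> core D j')"

text \<open>A Whitney decomposition: the maximal grid squares in the upper half plane contained in
  the core of their level, maximality being \<open>free\<close>.\<close>

definition tiles :: "(nat \<times> int \<times> int) set" where
  "tiles = {(j, i, k). 0 \<le> k \<and> sqr j i k \<subseteq> core D j \<and> free j i k}"

definition bottom :: "(nat \<times> int \<times> int) set" where
  "bottom = {(j, i, k). (j, i, k) \<in> tiles \<and> k = 0}"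

fun touches :: "nat \<times> int \<times> int \<Rightarrow> nat \<times> int \<times> int \<Rightarrow> bool" where
  "touches (j, i, k) (j', i', k') \<longleftrightarrow>
     lo j i \<le> lo j' (i' + 1) \<and> lo j' i' \<le> lo j (i + 1) \<and>
     lo j k \<le> lo j' (k' + 1) \<and> lo j' k' \<le> lo j (k + 1)"

section \<open>Arithmetic of dyadic intervals\<close>

lemma a_mono: "j' \<le> j \<Longrightarrow> a j' \<le> a j"
  using strict_mono_a by (simp add: strict_mono_less_eq)

lemma a_less: "j' < j \<Longrightarrow> a j' < a j"
  using strict_mono_a by (simp add: strict_mono_less)

lemma lo_le [simp]: "lo j i \<le> lo j i' \<longleftrightarrow> i \<le> i'"
  by (simp add: lo_def divide_le_cancel)

lemma lo_less [simp]: "lo j i < lo j i' \<longleftrightarrow> i < i'"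
  by (simp add: lo_def divide_less_cancel)

lemma lo_add: "lo j (i + k) = lo j i + lo j k"
  by (simp add: lo_def add_divide_distrib)

text \<open>Rewrites coarse grid points in units of a finer grid, after which comparisons concern
  integers.\<close>

lemma lo_scale:
  assumes "j' \<le> j" shows "lo j' i = lo j (i * 2 ^ (a j - a j'))"
proof -
  have "(2::real) ^ a j = 2 ^ (a j - a j') * 2 ^ a j'"
    using a_mono[OF assms] by (simp flip: power_add)
  then show ?thesis by (simp add: lo_def)
qed

lemma anc_self [simp]: "anc j j i = i"
  by (simp add: anc_def)

lemma anc_bounds:
  assumes "j' \<le> j"
  shows "lo j' (anc j' j i) \<le> lo j i" "lo j (i + 1) \<le> lo j' (anc j' j i + 1)"
proof -
  let ?t = "2 ^ (a j - a j') :: int"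
  have t: "?t > 0" by simp
  have "(i div ?t) * ?t + i mod ?t = i" "0 \<le> i mod ?t" "i mod ?t < ?t" "(i div ?t + 1) * ?t = (i div ?t) * ?t + ?t"
    using t by (simp_all only: div_mult_mod_eq pos_mod_sign pos_mod_bound distrib_right mult_1_left)
  then have "(i div ?t) * ?t \<le> i" "i + 1 \<le> (i div ?t + 1) * ?t"
    by linarith+
  then show "lo j' (anc j' j i) \<le> lo j i" "lo j (i + 1) \<le> lo j' (anc j' j i + 1)"
    unfolding lo_scale[OF assms] anc_def by auto
qed

lemma anc_eqI:
  assumes "j' \<le> j" "lo j' p \<le> lo j i" "lo j (i + 1) \<le> lo j' (p + 1)"
  shows "anc j' j i = p"
proof -
  let ?t = "2 ^ (a j - a j') :: int"
  have "p * ?t \<le> i" "i + 1 \<le> (p + 1) * ?t"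
    using assms(2,3) unfolding lo_scale[OF assms(1)] by auto
  then have "i = p * ?t + (i - p * ?t)" "0 \<le> i - p * ?t" "i - p * ?t < ?t"
    by (auto simp: distrib_right)
  then show ?thesis unfolding anc_def by (metis div_pos_pos_trivial add.right_neutral div_mult_self3 zero_less_power zero_less_numeral less_irrefl)
qed

lemma anc_anc:
  assumes "j1 \<le> j2" "j2 \<le> j"
  shows "anc j1 j2 (anc j2 j i) = anc j1 j i"
proof -
  have "a j - a j1 = (a j - a j2) + (a j2 - a j1)"
    using a_mono[OF assms(1)] a_mono[OF assms(2)] by simp
  then show ?thesis
    by (simp add: anc_def power_add zdiv_zmult2_eq)
qed

lemma anc_mono: "i \<le> i' \<Longrightarrow> anc j' j i \<le> anc j' j i'"
  by (simp add: anc_def zdiv_mono1)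

lemma sqr_subsetI:
  assumes "lo j' p \<le> lo j i" "lo j (i + 1) \<le> lo j' (p + 1)"
    "lo j' q \<le> lo j k" "lo j (k + 1) \<le> lo j' (q + 1)"
  shows "sqr j i k \<subseteq> sqr j' p q"
  using assms by (auto simp: sqr_def)

lemma sqr_subset_anc: "j' \<le> j \<Longrightarrow> sqr j i k \<subseteq> sqr j' (anc j' j i) (anc j' j k)"
  by (intro sqr_subsetI anc_bounds)

lemma free_not_covered:
  assumes "free j i k" "(j', p, q) \<in> tiles" "j' < j"
  shows "\<not> (lo j' p \<le> lo j i \<and> lo j (i + 1) \<le> lo j' (p + 1) \<and> lo j' q \<le> lo j k \<and> lo j (k + 1) \<le> lo j' (q + 1))"
proof
  assume "lo j' p \<le> lo j i \<and> lo j (i + 1) \<le> lo j' (p + 1) \<and> lo j' q \<le> lo j k \<and> lo j (k + 1) \<le> lo j' (q + 1)"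
  then have "anc j' j i = p" "anc j' j k = q"
    using assms(3) by (auto intro: anc_eqI)
  then show False using assms by (auto simp: free_def tiles_def)
qed

subsection \<open>Escaping to the complement\<close>

text \<open>Squares from which at most \<open>n\<close> edge steps through squares above the real line and outside
  the earlier shells lead out of the core.\<close>

primrec esc :: "nat \<Rightarrow> nat \<Rightarrow> (int \<times> int) set" where
  "esc j 0 = {(i, k). 0 \<le> k \<and> \<not> sqr j i k \<subseteq> core D j}"
| "esc j (Suc n) = esc j n \<union>
     {(i, k). 1 \<le> k \<and> free j i k \<and> (\<exists>i' k'. \<bar>i' - i\<bar> + \<bar>k' - k\<bar> = 1 \<and> (i', k') \<in> esc j n)}"

text \<open>One coordinate of the reason why the coarser square around a given one leaves its core:
  both coordinates are close to those of a point outside \<open>D\<close>. The split allows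
  horizontal and vertical moves to be treated separately.\<close>

definition near :: "nat \<Rightarrow> nat \<Rightarrow> int \<Rightarrow> real \<Rightarrow> bool" where
  "near j' j i u \<longleftrightarrow> (\<exists>x\<in>{lo j' (anc j' j i)..lo j' (anc j' j i + 1)}. \<bar>x - u\<bar> < 1 / 2 ^ j')"

lemma not_core_if_near:
  assumes "near j' j i u" "near j' j k v" "(u, v) \<notin> D"
  shows "\<not> sqr j' (anc j' j i) (anc j' j k) \<subseteq> core D j'"
proof -
  obtain x y where "x\<in>{lo j' (anc j' j i)..lo j' (anc j' j i + 1)}" "\<bar>x - u\<bar> < 1 / 2 ^ j'"
    "y\<in>{lo j' (anc j' j k)..lo j' (anc j' j k + 1)}" "\<bar>y - v\<bar> < 1 / 2 ^ j'"
    using assms unfolding near_def by blast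
  then have "(x, y) \<in> sqr j' (anc j' j i) (anc j' j k)"
    "\<not> 1 / 2 ^ j' \<le> max \<bar>fst (x, y) - fst (u, v)\<bar> \<bar>snd (x, y) - snd (u, v)\<bar>"
    by (auto simp: sqr_def)
  then show ?thesis using assms(3) unfolding core_def by blast
qed

text \<open>Moving towards \<open>u\<close> either keeps the coarser interval or gives one with an
  endpoint between \<open>x\<close> and \<open>u\<close>, which is at least as close to
  \<open>u\<close>.\<close>

lemma near_between:
  assumes near: "near j' j i u" and j: "j' \<le> j"
    and n: "lo j n \<le> u" "u \<le> lo j (n + 1)"
    and i': "i \<le> i' \<and> i' \<le> n \<or> n \<le> i' \<and> i' \<le> i"
  shows "near j' j i' u"
proof -
  let ?A = "anc j' j"
  obtain x where x: "lo j' (?A i) \<le> x" "x \<le> lo j' (?A i + 1)" "\<bar>x - u\<bar> < 1 / 2 ^ j'"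
    using near unfolding near_def by auto
  have N: "lo j' (?A n) \<le> u" "u \<le> lo j' (?A n + 1)"
    using anc_bounds[OF j, of n] n by auto
  consider "?A i' = ?A i" | "?A i < ?A i'" "?A i' \<le> ?A n" | "?A n \<le> ?A i'" "?A i' < ?A i"
    using i' anc_mono[of _ _ j' j] by (metis order.order_iff_strict)
  then show ?thesis
  proof cases
    case 1
    then show ?thesis using near by (simp add: near_def)
  next
    case 2
    then have "lo j' (?A i + 1) \<le> lo j' (?A i')" "lo j' (?A i') \<le> lo j' (?A n)" by auto
    then have "x \<le> lo j' (?A i')" "lo j' (?A i') \<le> u" using x N by linarith+
    then show ?thesis unfolding near_def
      using x(3) by (intro bexI[of _ "lo j' (?A i')"]) auto
  next
    case 3
    then have "lo j' (?A i' + 1) \<le> lo j' (?A i)" "lo j' (?A n + 1) \<le> lo j' (?A i' + 1)" by auto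
    then have "lo j' (?A i' + 1) \<le> x" "u \<le> lo j' (?A i' + 1)" using x N by linarith+
    then show ?thesis unfolding near_def
      using x(3) by (intro bexI[of _ "lo j' (?A i' + 1)"]) auto
  qed
qed

text \<open>A lattice walk towards the square around \<open>(u, v)\<close>. Nearness persists along
  it, so every square passed is free, and the final square contains a point outside
  \<open>D\<close>.\<close>

lemma esc_path:
  assumes uv: "(u, v) \<notin> D"
    and n: "lo j n \<le> u" "u \<le> lo j (n + 1)"
    and m: "lo j m \<le> v" "v \<le> lo j (m + 1)" "0 \<le> m"
    and near: "\<And>j'. j' < j \<Longrightarrow> near j' j i u" "\<And>j'. j' < j \<Longrightarrow> near j' j k v"
    and k: "1 \<le> k \<or> i = n \<and> k = m"
  shows "\<exists>l. (i, k) \<in> esc j l"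
  using near k
proof (induction "nat (\<bar>n - i\<bar> + \<bar>m - k\<bar>)" arbitrary: i k)
  case 0
  then have "i = n" "k = m" by linarith+
  then have "(u, v) \<in> sqr j i k" "0 \<le> k" using n m by (auto simp: sqr_def)
  then have "(i, k) \<in> esc j 0" using uv core_subset by auto
  then show ?case by blast
next
  case (Suc d)
  then have k: "1 \<le> k" by auto
  obtain i' k' where *: "i \<le> i' \<and> i' \<le> n \<or> n \<le> i' \<and> i' \<le> i" "k \<le> k' \<and> k' \<le> m \<or> m \<le> k' \<and> k' \<le> k"
    "\<bar>i' - i\<bar> + \<bar>k' - k\<bar> = 1" "\<bar>n - i'\<bar> + \<bar>m - k'\<bar> = \<bar>n - i\<bar> + \<bar>m - k\<bar> - 1" "1 \<le> k' \<or> i' = n \<and> k' = m"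
  proof -
    \<comment> \<open>Horizontal moves come first, so row 0 is entered at the target only.\<close>
    consider "i < n" | "i > n" | "i = n" "k < m" | "i = n" "k > m"
      using Suc.hyps(2) by fastforce
    then show thesis
    proof cases
      case 1 then show thesis using k by (intro that[of "i + 1" k]) auto
    next
      case 2 then show thesis using k by (intro that[of "i - 1" k]) auto
    next
      case 3 then show thesis using k by (intro that[of i "k + 1"]) auto
    next
      case 4 then show thesis using k m by (intro that[of i "k - 1"]) auto
    qed
  qed
  have "\<exists>l. (i', k') \<in> esc j l"
  proof (rule Suc.hyps(1))
    show "d = nat (\<bar>n - i'\<bar> + \<bar>m - k'\<bar>)" using Suc.hyps(2) *(4) by linarith
    show "near j' j i' u" "near j' j k' v" if "j' < j" for j'
      using near_between[OF Suc.prems(1)[OF that] less_imp_le[OF that] n *(1)]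
        near_between[OF Suc.prems(2)[OF that] less_imp_le[OF that] m(1,2) *(2)] .
  qed fact
  moreover have "free j i k"
    unfolding free_def using not_core_if_near Suc.prems(1,2) uv by blast
  ultimately obtain l where "(i, k) \<in> esc j (Suc l)" using k *(3) by auto
  then show ?case by blast
qed

text \<open>Freeness at level \<open>j - 1\<close> provides a point outside \<open>D\<close> close
  to the coarser square, and nearness at that level implies nearness at all coarser ones.\<close>

lemma esc_exists:
  assumes k: "1 \<le> k" and free: "free j i k"
  shows "\<exists>l. (i, k) \<in> esc j l"
proof -
  have "\<exists>u v. (u, v) \<notin> D \<and> 0 \<le> v \<and> (\<forall>j'<j. near j' j i u \<and> near j' j k v)"
  proof (cases j)
    case 0
    \<comment> \<open>With no coarser level there is no nearness to check, and any point outside the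
      bounded set \<open>D\<close> serves.\<close>
    obtain B where B: "\<And>z. z \<in> D \<Longrightarrow> norm z \<le> B"
      using bounded_D by (auto simp: bounded_iff)
    have "norm (\<bar>B\<bar> + 1 :: real) \<le> norm (\<bar>B\<bar> + 1, 0 :: real)" by (simp add: norm_Pair)
    then have "(\<bar>B\<bar> + 1, 0) \<notin> D" using B[of "(\<bar>B\<bar> + 1, 0)"] by auto
    then show ?thesis using 0 by blast
  next
    case (Suc j0)
    then have "\<not> sqr j0 (anc j0 j i) (anc j0 j k) \<subseteq> core D j0" using free by (auto simp: free_def)
    then obtain x y u v where xy: "(x, y) \<in> sqr j0 (anc j0 j i) (anc j0 j k)"
      and uv: "(u, v) \<notin> D" "\<bar>x - u\<bar> < 1 / 2 ^ j0" "\<bar>y - v\<bar> < 1 / 2 ^ j0"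
    proof -
      obtain z w where zw: "z \<in> sqr j0 (anc j0 j i) (anc j0 j k)" "w \<notin> D"
        "\<not> 1 / 2 ^ j0 \<le> max \<bar>fst z - fst w\<bar> \<bar>snd z - snd w\<bar>"
        using \<open>\<not> sqr j0 _ _ \<subseteq> _\<close> unfolding core_def by blast
      then show thesis by (intro that[of "fst z" "snd z" "fst w" "snd w"]) auto
    qed
    have "0 \<le> anc j0 j k" using k by (simp add: anc_def pos_imp_zdiv_nonneg_iff)
    then have "0 \<le> lo j0 (anc j0 j k)" by (simp add: lo_def)
    then have "0 \<le> y" using xy by (auto simp: sqr_def)
    \<comment> \<open>The target must lie in the upper half plane. As \<open>y\<close> is
      nonnegative, reflecting \<open>v\<close> does not move it away from \<open>y\<close>.\<close>
    then have v: "\<bar>y - \<bar>v\<bar>\<bar> < 1 / 2 ^ j0" using uv(3) by linarith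
    have "(u, \<bar>v\<bar>) \<notin> D" using uv(1) sym_D[of u v] by (auto simp: abs_if)
    moreover have "near j' j i u \<and> near j' j k \<bar>v\<bar>" if "j' < j" for j'
    proof -
      have le: "j' \<le> j0" "j0 \<le> j" using that Suc by auto
      have "1 / 2 ^ j0 \<le> (1 / 2 ^ j' :: real)" using le by (simp add: field_simps)
      moreover have "(x, y) \<in> sqr j' (anc j' j i) (anc j' j k)"
        using sqr_subset_anc[OF le(1), of "anc j0 j i" "anc j0 j k"] xy le by (auto simp: anc_anc)
      ultimately show ?thesis using uv(2) v unfolding near_def sqr_def
        by (intro conjI bexI[of _ x] bexI[of _ y]) auto
    qed
    ultimately show ?thesis by (intro exI[of _ u] exI[of _ "\<bar>v\<bar>"]) auto
  qed
  then obtain u v where uv: "(u, v) \<notin> D" "0 \<le> v" "\<forall>j'<j. near j' j i u \<and> near j' j k v" by blast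
  have fl: "lo j \<lfloor>t * 2 ^ a j\<rfloor> \<le> t" "t \<le> lo j (\<lfloor>t * 2 ^ a j\<rfloor> + 1)" for t
    unfolding lo_def by (simp_all add: divide_le_eq le_divide_eq floor_correct less_imp_le)
  show ?thesis
    by (rule esc_path[OF uv(1) fl fl]) (use uv k in auto)
qed

lemma esc_cases:
  "(i, k) \<in> esc j n \<Longrightarrow> \<not> sqr j i k \<subseteq> core D j \<or> 1 \<le> k \<and> free j i k"
  by (induction n) auto

text \<open>Follows from boundedness of \<open>D\<close>; it bounds the escape lengths within a
  shell.\<close>

lemma finite_level: "finite {(i, k). (j, i, k) \<in> tiles}"
proof -
  obtain B where B: "\<And>z. z \<in> D \<Longrightarrow> norm z \<le> B"
    using bounded_D by (auto simp: bounded_iff)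
  let ?N = "\<lceil>B * 2 ^ a j\<rceil>"
  have bnd: "m \<in> {- ?N..?N}" if "\<bar>lo j m\<bar> \<le> B" for m
  proof -
    have "\<bar>real_of_int m\<bar> \<le> B * 2 ^ a j"
      using that by (simp add: lo_def divide_le_eq)
    then show ?thesis by (simp add: abs_le_iff le_ceiling_iff minus_le_iff)
  qed
  have "(i, k) \<in> {- ?N..?N} \<times> {- ?N..?N}" if "(j, i, k) \<in> tiles" for i k
  proof -
    have "(lo j i, lo j k) \<in> sqr j i k" by (simp add: sqr_def)
    then have "(lo j i, lo j k) \<in> D" using that core_subset by (auto simp: tiles_def)
    then have "norm (lo j i, lo j k) \<le> B" by (rule B)
    then have "\<bar>lo j i\<bar> \<le> B" "\<bar>lo j k\<bar> \<le> B"
      using norm_fst_le[of "lo j i" "lo j k"] norm_snd_le[of "lo j k" "lo j i"] by auto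
    then show ?thesis using bnd by blast
  qed
  then have "{(i, k). (j, i, k) \<in> tiles} \<subseteq> {- ?N..?N} \<times> {- ?N..?N}" by blast
  then show ?thesis by (rule finite_subset) simp
qed

lemma touches_sym: "touches s t \<Longrightarrow> touches t s"
  by (cases s; cases t) auto

lemma touches_refl: "touches t t"
  by (cases t) auto

text \<open>Within a shell the tiles farthest from the complement come first, so that the next tile on an
  escape route is always added later.\<close>

theorem tiles_acyclic:
  assumes l: "3 \<le> l"
    and c: "\<And>M. M \<in> cliques tiles touches \<Longrightarrow> length M = Suc l \<Longrightarrow> cob c M = 0"
    and c0: "\<And>M. M \<in> cliques tiles touches \<Longrightarrow> set M \<subseteq> bottom \<Longrightarrow> length M = l \<Longrightarrow> c M = 0"
  shows "\<exists>b. (\<forall>M\<in>cliques tiles touches. length M = l \<longrightarrow> c M = cob b M) \<and> (\<forall>M. set M \<subseteq> bottom \<longrightarrow> b M = 0)"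
proof -
  define g where "g j s = (LEAST n. s \<in> esc j n)" for j s
  have "\<exists>G. \<forall>i k. (j, i, k) \<in> tiles \<longrightarrow> g j (i, k) \<le> G" for j
  proof -
    have "finite (g j ` {(i, k). (j, i, k) \<in> tiles})" using finite_level by blast
    then show ?thesis
      by (intro exI[of _ "Max (g j ` {(i, k). (j, i, k) \<in> tiles})"]) (auto intro!: Max_ge)
  qed
  then obtain G where G: "\<And>j i k. (j, i, k) \<in> tiles \<Longrightarrow> g j (i, k) \<le> G j" by metis
  \<comment> \<open>Coarse shells first, then long escape routes, then the encoding. Subtracting
    from the bound \<open>G j\<close> turns decreasing route length into a well-founded
    order.\<close>
  define R where "R = inv_image (less_than <*lex*> less_than <*lex*> less_than)
     (\<lambda>(j, i, k). (j, G j - g j (i, k), to_nat (i, k)))"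
  have wf: "wf R" unfolding R_def by (intro wf_inv_image wf_lex_prod wf_less_than)
  have tr: "trans R" unfolding R_def by (intro trans_inv_image) auto
  have tot: "total_on (tiles - bottom) R"
  proof -
    have "(s, t) \<in> R \<or> (t, s) \<in> R" if "s \<noteq> t" for s t
    proof -
      obtain j i k j' i' k' where eq: "s = (j, i, k)" "t = (j', i', k')" by (cases s; cases t)
      have "j = j' \<Longrightarrow> to_nat (i, k) \<noteq> to_nat (i', k')" using that by (simp add: eq)
      then show ?thesis unfolding R_def eq by (simp only: in_inv_image prod.case in_lex_prod less_than_iff) linarith
    qed
    then show ?thesis unfolding total_on_def by blast
  qed
  have link: "acyclic_from 2 {u \<in> tiles. u \<noteq> v \<and> touches u v \<and> (u \<in> bottom \<or> (u, v) \<in> R)} touches"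
    if "v \<in> tiles - bottom" for v
  proof -
    obtain j i k where v: "v = (j, i, k)" by (cases v)
    have tv: "(j, i, k) \<in> tiles" and k: "1 \<le> k"
      using that by (auto simp: v bottom_def tiles_def)
    then have fr: "free j i k" and cr: "sqr j i k \<subseteq> core D j" by (auto simp: tiles_def)
    obtain n where "(i, k) \<in> esc j n" using esc_exists[OF k fr] by blast
    then have g: "(i, k) \<in> esc j (g j (i, k))" "\<And>m. m < g j (i, k) \<Longrightarrow> (i, k) \<notin> esc j m"
      unfolding g_def by (auto intro: LeastI dest: not_less_Least)
    \<comment> \<open>A tile lies in its core and thus not in \<open>esc j 0\<close>; so it entered
      at a successor stage, through a neighbour with a shorter route.\<close>
    moreover have "g j (i, k) \<noteq> 0" using g(1) cr by (intro notI) auto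
    then obtain n where n: "g j (i, k) = Suc n" using not0_implies_Suc by blast
    ultimately obtain i' k' where nb: "\<bar>i' - i\<bar> + \<bar>k' - k\<bar> = 1" and esc: "(i', k') \<in> esc j n"
      by auto
    let ?Y = "{u \<in> tiles. u \<noteq> v \<and> touches u v \<and> (u \<in> bottom \<or> (u, v) \<in> R)}"
    \<comment> \<open>The sides of a tile in units of the grid of \<open>v\<close>, correct for
      tiles that are not finer than \<open>v\<close>.\<close>
    define xl :: "nat \<times> int \<times> int \<Rightarrow> int" where "xl = (\<lambda>(j', p, q). (p::int) * 2 ^ (a j - a j') :: int)"
    define xh :: "nat \<times> int \<times> int \<Rightarrow> int" where "xh = (\<lambda>(j', p, q). ((p::int) + 1) * 2 ^ (a j - a j') :: int)"
    define yl :: "nat \<times> int \<times> int \<Rightarrow> int" where "yl = (\<lambda>(j', p, q). (q::int) * 2 ^ (a j - a j') :: int)"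
    define yh :: "nat \<times> int \<times> int \<Rightarrow> int" where "yh = (\<lambda>(j', p, q). ((q::int) + 1) * 2 ^ (a j - a j') :: int)"
    note defs = xl_def xh_def yl_def yh_def
    have le: "j' \<le> j" if "(j', p, q) \<in> ?Y" for j' p q
    proof (rule ccontr)
      \<comment> \<open>A finer tile could precede \<open>v\<close> only as a bottom tile, but then
        its top edge lies strictly below \<open>v\<close>.\<close>
      assume "\<not> j' \<le> j"
      then have "((j', p, q), v) \<notin> R" "a j < a j'" using a_less by (auto simp: R_def v)
      then have "q = 0" "touches (j', p, q) v" using that by (auto simp: bottom_def)
      then have "lo j k \<le> lo j' 1" by (simp add: v)
      moreover have "lo j 1 \<le> lo j k" using k by simp
      moreover have "lo j' 1 < lo j 1" using \<open>a j < a j'\<close> by (simp add: lo_def field_simps)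
      ultimately show False by linarith
    qed
    show ?thesis
    proof (rule acyclic_from_link[where xl = xl and xh = xh and yl = yl and yh = yh and i = i and k = k
          and i' = i' and k' = k', OF _ _ _ _ _ nb])
      fix u w assume uw: "u \<in> ?Y" "w \<in> ?Y"
      obtain j1 p1 q1 j2 p2 q2 where eq: "u = (j1, p1, q1)" "w = (j2, p2, q2)" by (cases u; cases w)
      have "j1 \<le> j" "j2 \<le> j" using le uw unfolding eq by blast+
      then show "touches u w \<longleftrightarrow> xl u \<le> xh w \<and> xl w \<le> xh u \<and> yl u \<le> yh w \<and> yl w \<le> yh u"
        unfolding eq touches.simps defs by (simp add: lo_scale)
    next
      fix u assume u: "u \<in> ?Y"
      obtain j1 p q where eq: "u = (j1, p, q)" by (cases u)
      have j1: "j1 \<le> j" using le u unfolding eq by blast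
      show "xl u < xh u \<and> yl u < yh u" by (simp add: eq defs)
      have "touches u v" using u by blast
      then show "xl u \<le> i + 1 \<and> i \<le> xh u \<and> yl u \<le> k + 1 \<and> k \<le> yh u"
        unfolding eq v touches.simps defs using j1 by (simp add: lo_scale)
      have cov: "xl u \<le> i'' \<and> i'' + 1 \<le> xh u \<and> yl u \<le> k'' \<and> k'' + 1 \<le> yh u \<longleftrightarrow>
        lo j1 p \<le> lo j i'' \<and> lo j (i'' + 1) \<le> lo j1 (p + 1) \<and> lo j1 q \<le> lo j k'' \<and> lo j (k'' + 1) \<le> lo j1 (q + 1)"
        for i'' k'' using j1 by (simp add: eq defs lo_scale)
      have ut: "(j1, p, q) \<in> tiles" using u eq by blast
      show "\<not> (xl u \<le> i \<and> i + 1 \<le> xh u \<and> yl u \<le> k \<and> k + 1 \<le> yh u)"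
      proof (cases "j1 = j")
        case True
        then show ?thesis unfolding cov using u by (auto simp: eq v)
      next
        case False
        then show ?thesis unfolding cov using free_not_covered[OF fr ut] j1 by auto
      qed
      show "\<not> (xl u \<le> i' \<and> i' + 1 \<le> xh u \<and> yl u \<le> k' \<and> k' + 1 \<le> yh u)"
      proof
        assume A: "xl u \<le> i' \<and> i' + 1 \<le> xh u \<and> yl u \<le> k' \<and> k' + 1 \<le> yh u"
        then have "sqr j i' k' \<subseteq> sqr j1 p q" unfolding cov by (intro sqr_subsetI) auto
        then have cr': "sqr j i' k' \<subseteq> core D j"
          using ut core_mono[OF j1, of D] by (auto simp: tiles_def)
        \<comment> \<open>The neighbour lies in the core, so it is itself free and above the real
          line. A tile covering it must then be that very square.\<close>
        then have fr': "1 \<le> k'" "free j i' k'" using esc_cases[OF esc] by auto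
        have "j1 = j" using free_not_covered[OF fr'(2) ut] A j1 unfolding cov by fastforce
        then have "p = i'" "q = k'" using A unfolding cov by auto
        then have ueq: "u = (j, i', k')" using eq \<open>j1 = j\<close> by simp
        have "u \<notin> bottom" using fr' by (auto simp: ueq bottom_def)
        then have "(u, v) \<in> R" using u by blast
        moreover have "g j (i', k') \<le> n" unfolding g_def using esc by (intro Least_le)
        \<comment> \<open>The neighbour has a shorter route, hence a later place. The bound
          \<open>G\<close> at \<open>v\<close> keeps the truncated subtraction strict.\<close>
        ultimately show False
          using n G[OF tv] by (auto simp: R_def ueq v)
      qed
    qed
  qed
  show ?thesis
    by (rule attach_vertices[OF wf tr tot touches_sym touches_refl link _ c c0]) (use l in auto)
qed

end

section \<open>The nerve of the enlarged tiles\<close>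

context tiling
begin

text \<open>A quarter of the mesh of the next shell: small enough that enlarging creates no new
  contacts, even with finer tiles.\<close>

definition eps :: "nat \<Rightarrow> real" where
  "eps j = lo (Suc j) 1 / 4"

fun wide :: "nat \<times> int \<times> int \<Rightarrow> (real \<times> real) set" where
  "wide (j, i, k) = {lo j i - eps j<..<lo j (i + 1) + eps j} \<times> {lo j k - eps j<..<lo j (k + 1) + eps j}"

section \<open>Contacts between enlarged tiles\<close>

lemma lo_1_pos: "0 < lo j 1"
  by (simp add: lo_def)

lemma lo_1_mono: "j \<le> j' \<Longrightarrow> lo j' 1 \<le> lo j 1"
  using a_mono[of j j'] by (simp add: lo_def field_simps)

lemma eps_pos: "0 < eps j"
  by (simp add: eps_def lo_1_pos)

lemma lo_1_le: "lo j 1 \<le> 1 / 2 ^ Suc j"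
  using less_a[of j] by (simp add: lo_def divide_le_eq flip: power_Suc)

lemma open_wide: "open (wide t)"
  by (cases t) (auto intro!: open_Times)

lemma sqr_subset_wide: "sqr j i k \<subseteq> wide (j, i, k)"
  using eps_pos[of j] by (auto simp: sqr_def)

lemma lo_gap:
  assumes "lo j m < lo j n + lo j 1" shows "m \<le> n"
proof -
  have "lo j m < lo j (n + 1)" using assms by (simp add: lo_add)
  then show ?thesis by simp
qed

text \<open>The two enlargements add up to less than one mesh of shell \<open>Suc j\<close>, and
  grid points of that shell less than a mesh out of order are not out of order at all.\<close>

lemma anc_touch:
  assumes "j < j'" and x: "lo j i - eps j < x" "x < lo j (i + 1) + eps j"
    "lo j' i' - eps j' < x" "x < lo j' (i' + 1) + eps j'"
  shows "lo j i \<le> lo (Suc j) (anc (Suc j) j' i' + 1)" "lo (Suc j) (anc (Suc j) j' i') \<le> lo j (i + 1)"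
proof -
  let ?P = "anc (Suc j) j' i'"
  have P: "lo (Suc j) ?P \<le> lo j' i'" "lo j' (i' + 1) \<le> lo (Suc j) (?P + 1)"
    using anc_bounds[of "Suc j" j'] assms(1) by auto
  have e: "eps j' \<le> eps j"
    using lo_1_mono[of "Suc j" "Suc j'"] assms(1) by (simp add: eps_def)
  have e2: "2 * eps j < lo (Suc j) 1"
    using lo_1_pos[of "Suc j"] by (simp add: eps_def)
  have s: "lo j m = lo (Suc j) (m * 2 ^ (a (Suc j) - a j))" for m
    by (rule lo_scale) simp
  have "lo j i < lo (Suc j) (?P + 1) + lo (Suc j) 1" "lo (Suc j) ?P < lo j (i + 1) + lo (Suc j) 1"
    using x P e e2 by linarith+
  then show "lo j i \<le> lo (Suc j) (?P + 1)" "lo (Suc j) ?P \<le> lo j (i + 1)"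
    unfolding s lo_le by (auto dest: lo_gap)
qed

text \<open>The cores grow by \<open>2 ^ -(j + 1)\<close> at each step, so a tile of shell \<open>j\<close> only meets the
  shells \<open>j - 1\<close>, \<open>j\<close> and \<open>j + 1\<close>.\<close>

lemma core_grows:
  assumes z0: "z0 \<in> core D j" and near: "\<bar>fst z - fst z0\<bar> \<le> 1 / 2 ^ Suc j" "\<bar>snd z - snd z0\<bar> \<le> 1 / 2 ^ Suc j"
  shows "z \<in> core D (Suc j)"
  unfolding core_def
proof (intro CollectI allI impI)
  fix w assume "w \<notin> D"
  then have "1 / 2 ^ j \<le> max \<bar>fst z0 - fst w\<bar> \<bar>snd z0 - snd w\<bar>"
    using z0 unfolding core_def by blast
  moreover have "(1 / 2 ^ j :: real) = 1 / 2 ^ Suc j + 1 / 2 ^ Suc j" by simp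
  ultimately show "1 / 2 ^ Suc j \<le> max \<bar>fst z - fst w\<bar> \<bar>snd z - snd w\<bar>"
    using near by linarith
qed

lemma near_interval:
  fixes x :: real
  assumes "l \<le> h" "p \<le> h" "l \<le> p + d" "p \<le> x" "x \<le> p + d"
  shows "\<exists>x0\<in>{l..h}. \<bar>x - x0\<bar> \<le> d"
proof -
  consider "x < l" | "l \<le> x" "x \<le> h" | "h < x" by linarith
  then show ?thesis
    using assms by cases (force intro: bexI[of _ l], force intro: bexI[of _ x], force intro: bexI[of _ h])
qed

lemma sqr_subset_core_Suc:
  assumes core: "sqr j i k \<subseteq> core D j"
    and p: "lo j i \<le> lo (Suc j) (p + 1)" "lo (Suc j) p \<le> lo j (i + 1)"
    and q: "lo j k \<le> lo (Suc j) (q + 1)" "lo (Suc j) q \<le> lo j (k + 1)"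
  shows "sqr (Suc j) p q \<subseteq> core D (Suc j)"
proof
  fix z assume z: "z \<in> sqr (Suc j) p q"
  let ?d = "lo (Suc j) 1"
  have "?d \<le> 1 / 2 ^ Suc (Suc j)" by (rule lo_1_le)
  also have "\<dots> \<le> 1 / 2 ^ Suc j" by (simp add: field_simps)
  finally have d: "?d \<le> 1 / 2 ^ Suc j" .
  have "\<exists>x0\<in>{lo j i..lo j (i + 1)}. \<bar>fst z - x0\<bar> \<le> ?d"
    using z p by (intro near_interval[where p = "lo (Suc j) p"]) (auto simp: sqr_def lo_add lo_1_pos less_imp_le)
  then obtain x0 where x0: "x0\<in>{lo j i..lo j (i + 1)}" "\<bar>fst z - x0\<bar> \<le> ?d" by blast
  have "\<exists>y0\<in>{lo j k..lo j (k + 1)}. \<bar>snd z - y0\<bar> \<le> ?d"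
    using z q by (intro near_interval[where p = "lo (Suc j) q"]) (auto simp: sqr_def lo_add lo_1_pos less_imp_le)
  then obtain y0 where y0: "y0\<in>{lo j k..lo j (k + 1)}" "\<bar>snd z - y0\<bar> \<le> ?d" by blast
  have "(x0, y0) \<in> core D j" using x0 y0 core by (auto simp: sqr_def)
  then show "z \<in> core D (Suc j)"
    by (rule core_grows) (use x0 y0 d in auto)
qed

text \<open>The square of shell \<open>Suc j\<close> around the finer tile touches the coarser one
  and so lies in \<open>core D (Suc j)\<close>. Maximality of tiles forces
  \<open>j' = Suc j\<close>, and that square is the finer tile itself.\<close>

lemma touches_if_wide_less:
  assumes t: "(j, i, k) \<in> tiles" "(j', i', k') \<in> tiles" "j < j'"
    and z: "z \<in> wide (j, i, k)" "z \<in> wide (j', i', k')"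
  shows "touches (j, i, k) (j', i', k')"
proof -
  let ?p = "anc (Suc j) j' i'" and ?q = "anc (Suc j) j' k'"
  have x: "lo j i \<le> lo (Suc j) (?p + 1)" "lo (Suc j) ?p \<le> lo j (i + 1)"
    by (rule anc_touch[where x = "fst z"]; use z t in auto)+
  have y: "lo j k \<le> lo (Suc j) (?q + 1)" "lo (Suc j) ?q \<le> lo j (k + 1)"
    by (rule anc_touch[where x = "snd z"]; use z t in auto)+
  have "sqr (Suc j) ?p ?q \<subseteq> core D (Suc j)"
    using t(1) x y by (intro sqr_subset_core_Suc[of j i k]) (auto simp: tiles_def)
  then have "\<not> Suc j < j'" using t(2) by (auto simp: tiles_def free_def)
  then have "j' = Suc j" using t(3) by simp
  then show ?thesis using x y by simp
qed

lemma touches_if_wide: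
  assumes st: "s \<in> tiles" "t \<in> tiles" and z: "z \<in> wide s" "z \<in> wide t"
  shows "touches s t"
proof -
  obtain j i k j' i' k' where eq: "s = (j, i, k)" "t = (j', i', k')" by (cases s; cases t)
  consider "j < j'" | "j' < j" | "j = j'" by linarith
  then show ?thesis
  proof cases
    case 1
    then show ?thesis using touches_if_wide_less st z unfolding eq by blast
  next
    case 2
    then show ?thesis using touches_if_wide_less st z touches_sym unfolding eq by blast
  next
    case 3
    have "2 * eps j < lo j 1"
      using lo_1_mono[of j "Suc j"] lo_1_pos[of "Suc j"] by (simp add: eps_def)
    then have "lo j i < lo j (i' + 1) + lo j 1" "lo j i' < lo j (i + 1) + lo j 1"
       "lo j k < lo j (k' + 1) + lo j 1" "lo j k' < lo j (k + 1) + lo j 1"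
      using z 3 unfolding eq by auto
    then show ?thesis unfolding eq using 3 by (auto dest!: lo_gap)
  qed
qed

text \<open>Helly for boxes: taking the largest left end in each coordinate gives a point common to
  all closed squares. Lower edges have nonnegative height, and height zero for bottom tiles.\<close>

lemma clique_common_point:
  assumes M: "M \<in> cliques tiles touches" "M \<noteq> []"
  shows "\<exists>x y. 0 \<le> y \<and> (\<forall>t\<in>set M. (x, y) \<in> wide t) \<and> (set M \<subseteq> bottom \<longrightarrow> y = 0)"
proof -
  define X where "X = (\<lambda>(j, i, k). lo j i) ` set M"
  define Y where "Y = (\<lambda>(j, i, k). lo j k) ` set M"
  have fin: "finite X" "X \<noteq> {}" "finite Y" "Y \<noteq> {}" using M(2) by (auto simp: X_def Y_def)
  have mem: "(Max X, Max Y) \<in> wide t" if t: "t \<in> set M" for t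
  proof -
    obtain j i k where eq: "t = (j, i, k)" by (cases t)
    have "lo j i \<in> X" "lo j k \<in> Y" using t by (force simp: X_def Y_def eq)+
    moreover have "touches s t" if "s \<in> set M" for s using M that t by (auto simp: cliques_def)
    then have "x \<le> lo j (i + 1)" "y \<le> lo j (k + 1)" if "x \<in> X" "y \<in> Y" for x y
      using that by (auto simp: X_def Y_def eq)
    ultimately have "(Max X, Max Y) \<in> sqr j i k" using fin by (auto simp: sqr_def)
    then show ?thesis using sqr_subset_wide eq by blast
  qed
  have nn: "0 \<le> y" if "y \<in> Y" for y
    using that M(1) by (auto simp: Y_def cliques_def tiles_def lo_def)
  have "0 \<le> Max Y" using nn fin by (meson Max_in)
  moreover have "Max Y = 0" if "set M \<subseteq> bottom"
  proof -
    have "Y \<subseteq> {0}" using that by (auto simp: Y_def bottom_def lo_def)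
    then have "Y = {0}" using fin by auto
    then show ?thesis by simp
  qed
  ultimately show ?thesis using mem by blast
qed

lemma clique_if_common_point:
  assumes "set M \<subseteq> tiles" "\<And>t. t \<in> set M \<Longrightarrow> z \<in> wide t"
  shows "M \<in> cliques tiles touches"
  using assms by (auto simp: cliques_def intro!: touches_if_wide)

lemma bottom_if_wide_0:
  assumes "t \<in> tiles" "(x, 0) \<in> wide t"
  shows "t \<in> bottom"
proof -
  obtain j i k where eq: "t = (j, i, k)" by (cases t)
  have k: "0 \<le> k" using assms by (simp add: eq tiles_def)
  have "eps j < lo j 1"
    using lo_1_mono[of j "Suc j"] lo_1_pos[of "Suc j"] by (simp add: eps_def)
  then have "lo j k < lo j 0 + lo j 1" using assms by (simp add: eq lo_def)
  then show ?thesis using k assms(1) by (auto dest!: lo_gap simp: bottom_def eq)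
qed

text \<open>The grid squares around the point shrink and eventually lie in their cores; the first
  that does is a tile. Rounding down is compatible with \<open>anc\<close>.\<close>

lemma tiles_cover:
  assumes D: "open D" and xy: "(x, y) \<in> D" "0 \<le> y"
  shows "\<exists>t\<in>tiles. (x, y) \<in> wide t"
proof -
  define I :: "real \<Rightarrow> nat \<Rightarrow> int" where "I u j = \<lfloor>u * 2 ^ a j\<rfloor>" for u j
  have I: "lo j (I u j) \<le> u" "u \<le> lo j (I u j + 1)" for u j
    unfolding I_def lo_def by (simp_all add: divide_le_eq le_divide_eq floor_correct less_imp_le)
  have anc_I: "anc j' j (I u j) = I u j'" if "j' \<le> j" for u j j'
  proof -
    have "(2::real) ^ a j = 2 ^ a j' * 2 ^ (a j - a j')"
      using a_mono[OF that] by (simp flip: power_add)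
    then have "u * 2 ^ a j / real_of_int (2 ^ (a j - a j')) = u * 2 ^ a j'" by simp
    then show ?thesis
      unfolding anc_def I_def by (metis floor_divide_real_eq_div zero_le_numeral zero_le_power)
  qed
  obtain e where e: "e > 0" "ball (x, y) e \<subseteq> D" using D xy(1) open_contains_ball by blast
  obtain n where n: "(1/2::real) ^ n < e / 4" using e(1) real_arch_pow_inv[of "e / 4" "1/2"] by auto
  have "sqr n (I x n) (I y n) \<subseteq> core D n"
  proof
    fix z assume z: "z \<in> sqr n (I x n) (I y n)"
    have d: "lo n 1 \<le> 1 / 2 ^ n"
      using lo_1_le[of n] by (rule order_trans) (simp add: field_simps)
    have zx: "\<bar>fst z - x\<bar> \<le> 1 / 2 ^ n" "\<bar>snd z - y\<bar> \<le> 1 / 2 ^ n"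
      using z I(1)[of n x] I(2)[of x n] I(1)[of n y] I(2)[of y n] d by (auto simp: sqr_def lo_add)
    have "1 / 2 ^ n \<le> max \<bar>fst z - fst w\<bar> \<bar>snd z - snd w\<bar>" if "w \<notin> D" for w
    proof (rule ccontr)
      assume "\<not> 1 / 2 ^ n \<le> max \<bar>fst z - fst w\<bar> \<bar>snd z - snd w\<bar>"
      then have "\<bar>fst z - fst w\<bar> < 1 / 2 ^ n" "\<bar>snd z - snd w\<bar> < 1 / 2 ^ n" by auto
      moreover have "1 / 2 ^ n < e / 4" using n by (simp add: power_one_over)
      ultimately have "\<bar>x - fst w\<bar> < e / 2" "\<bar>y - snd w\<bar> < e / 2"
        using zx by linarith+
      moreover have "dist (x, y) w \<le> \<bar>x - fst w\<bar> + \<bar>y - snd w\<bar>"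
        by (cases w) (simp add: dist_Pair_Pair dist_real_def sqrt_sum_squares_le_sum_abs)
      ultimately have "w \<in> ball (x, y) e" by simp
      then show False using e that by blast
    qed
    then show "z \<in> core D n" unfolding core_def by blast
  qed
  then obtain j where j: "sqr j (I x j) (I y j) \<subseteq> core D j" "\<And>j'. j' < j \<Longrightarrow> \<not> sqr j' (I x j') (I y j') \<subseteq> core D j'"
    using exists_least_iff[of "\<lambda>j. sqr j (I x j) (I y j) \<subseteq> core D j"] by blast
  have "0 \<le> I y j" using xy(2) by (simp add: I_def)
  then have "(j, I x j, I y j) \<in> tiles"
    using j by (simp add: tiles_def free_def anc_I)
  moreover have "(x, y) \<in> sqr j (I x j) (I y j)" using I by (simp add: sqr_def)
  ultimately show ?thesis using sqr_subset_wide by blast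
qed

lemma wide_small:
  assumes "(j, i, k) \<in> tiles"
  shows "\<exists>z\<in>core D j. wide (j, i, k) \<subseteq> ball z (4 / 2 ^ a j)"
proof
  have "(lo j i, lo j k) \<in> sqr j i k" by (simp add: sqr_def)
  then show "(lo j i, lo j k) \<in> core D j" using assms by (auto simp: tiles_def)
  show "wide (j, i, k) \<subseteq> ball (lo j i, lo j k) (4 / 2 ^ a j)"
  proof
    fix w assume w: "w \<in> wide (j, i, k)"
    have e: "eps j < lo j 1"
      using lo_1_mono[of j "Suc j"] lo_1_pos[of "Suc j"] by (simp add: eps_def)
    have "\<bar>lo j i - fst w\<bar> < 2 * lo j 1" "\<bar>lo j k - snd w\<bar> < 2 * lo j 1"
      using w e eps_pos[of j] by (auto simp: lo_add)
    moreover have "dist (lo j i, lo j k) w \<le> \<bar>lo j i - fst w\<bar> + \<bar>lo j k - snd w\<bar>"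
      by (cases w) (simp add: dist_Pair_Pair dist_real_def sqrt_sum_squares_le_sum_abs)
    ultimately have "dist (lo j i, lo j k) w < 4 * lo j 1" by linarith
    then show "w \<in> ball (lo j i, lo j k) (4 / 2 ^ a j)" by (simp add: lo_def)
  qed
qed

end

text \<open>Each core is compact, so it has a Lebesgue number for \<open>W\<close>, which dictates
  the mesh of its shell.\<close>

lemma exists_tiling:
  assumes D: "bounded D" "\<And>x y. (x, - y) \<in> D \<longleftrightarrow> (x, y) \<in> D"
    and W: "\<And>A. A \<in> W \<Longrightarrow> open A" "D \<subseteq> \<Union>W"
  shows "\<exists>a. tiling D a \<and> (\<forall>j. \<forall>z\<in>core D j. \<exists>A\<in>W. ball z (4 / 2 ^ a j) \<subseteq> A)"
proof -
  have "\<exists>m::nat. \<forall>z\<in>core D j. \<exists>A\<in>W. ball z (4 / 2 ^ m) \<subseteq> A" for j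
  proof -
    obtain e where e: "e > 0" "\<And>z. z \<in> core D j \<Longrightarrow> \<exists>A\<in>W. ball z e \<subseteq> A"
      using Heine_Borel_lemma[OF compact_core[OF D(1)], of j W] W core_subset[of D j] by blast
    obtain m where "(1/2::real) ^ m < e / 4" using e(1) real_arch_pow_inv[of "e / 4" "1/2"] by auto
    then have "4 / 2 ^ m \<le> e" by (simp add: power_one_over)
    then show ?thesis using e(2) subset_ball[of "4 / 2 ^ m" e] by (meson subset_trans)
  qed
  then obtain m :: "nat \<Rightarrow> nat" where m: "\<And>j z. z \<in> core D j \<Longrightarrow> \<exists>A\<in>W. ball z (4 / 2 ^ m j) \<subseteq> A" by metis
  \<comment> \<open>Partial sums of successors are strictly increasing and dominate both
    \<open>m j\<close> and \<open>j\<close>.\<close>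
  define a where "a j = (\<Sum>i\<le>j. Suc (m i))" for j
  have "strict_mono a" by (rule strict_monoI_Suc) (simp add: a_def)
  moreover have "j < a j" for j
    by (induction j) (auto simp: a_def)
  ultimately have "tiling D a" using D by unfold_locales auto
  moreover have "\<exists>A\<in>W. ball z (4 / 2 ^ a j) \<subseteq> A" if "z \<in> core D j" for j z
  proof -
    have "m j \<le> a j" unfolding a_def by (cases j) auto
    then have "4 / 2 ^ a j \<le> (4 / 2 ^ m j :: real)" by (simp add: field_simps)
    then show ?thesis using m[OF that] subset_ball by (meson subset_trans)
  qed
  ultimately show ?thesis by blast
qed

section \<open>The slice structure of the quaternions\<close>

lemma vector_4:
  "(vector [w, x, y, z] :: 'a::zero ^ 4) $ 1 = w"
  "(vector [w, x, y, z] :: 'a::zero ^ 4) $ 2 = x"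
  "(vector [w, x, y, z] :: 'a::zero ^ 4) $ 3 = y"
  "(vector [w, x, y, z] :: 'a::zero ^ 4) $ 4 = z"
  unfolding vector_def by simp_all

definition im_norm :: "quat \<Rightarrow> real" where
  "im_norm q = sqrt ((q$2)\<^sup>2 + (q$3)\<^sup>2 + (q$4)\<^sup>2)"

definition unit_i :: quat where
  "unit_i = vector [0, 1, 0, 0]"

lemma qreal_nth [simp]: "qreal x $ 1 = x" "qreal x $ 2 = 0" "qreal x $ 3 = 0" "qreal x $ 4 = 0"
  by (simp_all add: qreal_def vector_4)

lemma quat_eq_iff: "(p::quat) = q \<longleftrightarrow> p$1 = q$1 \<and> p$2 = q$2 \<and> p$3 = q$3 \<and> p$4 = q$4"
  by (simp add: vec_eq_iff forall_4)

text \<open>The imaginary components of the square are twice the real part times those of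
  \<open>I\<close>. A nonzero real part would leave a real number with square
  \<open>-1\<close>.\<close>

lemma qS_iff: "I \<in> qS \<longleftrightarrow> I$1 = 0 \<and> (I$2)\<^sup>2 + (I$3)\<^sup>2 + (I$4)\<^sup>2 = 1"
proof
  assume "I \<in> qS"
  then have e: "I$1 * I$1 - I$2 * I$2 - I$3 * I$3 - I$4 * I$4 = -1"
    "I$1 * I$2 = 0" "I$1 * I$3 = 0" "I$1 * I$4 = 0"
    by (auto simp: qS_def qmult_def quat_eq_iff vector_4)
  have "I$1 = 0"
  proof (rule ccontr)
    assume "I$1 \<noteq> 0"
    then have "I$1 * I$1 = -1" using e by auto
    then show False using zero_le_square[of "I$1"] by linarith
  qed
  then show "I$1 = 0 \<and> (I$2)\<^sup>2 + (I$3)\<^sup>2 + (I$4)\<^sup>2 = 1"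
    using e(1) by (simp add: power2_eq_square)
qed (auto simp: qS_def qmult_def quat_eq_iff vector_4 power2_eq_square)

lemma unit_i_qS: "unit_i \<in> qS"
  by (simp add: qS_iff unit_i_def vector_4)

lemma minus_qS: "I \<in> qS \<Longrightarrow> - I \<in> qS"
  by (simp add: qS_iff)

lemma im_norm_nonneg [simp]: "0 \<le> im_norm q"
  by (simp add: im_norm_def)

lemma im_norm_add:
  assumes "I \<in> qS" shows "im_norm (qreal x + y *\<^sub>R I) = \<bar>y\<bar>"
proof -
  have "(y * I$2)\<^sup>2 + (y * I$3)\<^sup>2 + (y * I$4)\<^sup>2 = y\<^sup>2 * ((I$2)\<^sup>2 + (I$3)\<^sup>2 + (I$4)\<^sup>2)"
    by (simp add: power_mult_distrib distrib_left)
  then show ?thesis using assms by (simp add: im_norm_def qS_iff)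
qed

lemma fst_add: "I \<in> qS \<Longrightarrow> (qreal x + y *\<^sub>R I) $ 1 = x"
  by (simp add: qS_iff)

definition im_unit :: "quat \<Rightarrow> quat" where
  "im_unit q = (1 / im_norm q) *\<^sub>R (q - qreal (q$1))"

lemma im_unit:
  assumes "0 < im_norm q"
  shows "im_unit q \<in> qS" "qreal (q$1) + im_norm q *\<^sub>R im_unit q = q"
proof -
  have "(im_norm q)\<^sup>2 = (q$2)\<^sup>2 + (q$3)\<^sup>2 + (q$4)\<^sup>2" by (simp add: im_norm_def)
  moreover have "(im_norm q)\<^sup>2 > 0" using assms by simp
  ultimately have "((q$2)\<^sup>2 + (q$3)\<^sup>2 + (q$4)\<^sup>2) / (im_norm q)\<^sup>2 = 1" by simp
  then show "im_unit q \<in> qS"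
    by (simp add: qS_iff im_unit_def power_divide add_divide_distrib)
  show "qreal (q$1) + im_norm q *\<^sub>R im_unit q = q"
    using assms by (simp add: im_unit_def)
qed

lemma im_norm_0: "im_norm q = 0 \<Longrightarrow> q = qreal (q$1)"
proof -
  assume "im_norm q = 0"
  then have "(q$2)\<^sup>2 + (q$3)\<^sup>2 + (q$4)\<^sup>2 = 0" by (simp add: im_norm_def)
  then have "(q$2)\<^sup>2 = 0" "(q$3)\<^sup>2 = 0" "(q$4)\<^sup>2 = 0"
    using zero_le_power2[of "q$2"] zero_le_power2[of "q$3"] zero_le_power2[of "q$4"] by linarith+
  then show ?thesis by (simp add: quat_eq_iff)
qed

section \<open>The imaginary unit function\<close>

lemma Iu_eq:
  assumes "0 < im_norm q" shows "Iu q = im_unit q"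
  unfolding Iu_def
proof (rule the_equality)
  show "im_unit q \<in> qS \<and> q \<in> Cplus (im_unit q)"
    using im_unit[OF assms] assms unfolding Cplus_def by (metis (mono_tags, lifting) mem_Collect_eq)
next
  fix I assume I: "I \<in> qS \<and> q \<in> Cplus I"
  then obtain x y where q: "q = qreal x + y *\<^sub>R I" and y: "y > 0" unfolding Cplus_def by blast
  then have "q$1 = x" "im_norm q = y" using I im_norm_add[of I x y] by (auto simp: qS_iff)
  then show "I = im_unit q" using y by (simp add: im_unit_def q)
qed

lemma Iu_nonzero: "0 < im_norm q \<Longrightarrow> Iu q \<noteq> 0"
  using im_unit(1)[of q] by (auto simp: Iu_eq qS_iff)

lemma Iu_add:
  assumes "I \<in> qS" "0 < y" shows "Iu (qreal x + y *\<^sub>R I) = I"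
proof -
  have n: "im_norm (qreal x + y *\<^sub>R I) = y" using assms im_norm_add[of I x y] by simp
  then show ?thesis
    using assms by (simp add: Iu_eq im_unit_def fst_add del: vector_add_component)
qed

lemma continuous_qreal [continuous_intros]:
  "continuous_on A f \<Longrightarrow> continuous_on A (\<lambda>x. qreal (f x))"
proof -
  have "qreal = (\<lambda>x. x *\<^sub>R qreal 1)" by (rule ext) (simp add: quat_eq_iff)
  moreover assume "continuous_on A f"
  ultimately show ?thesis by (metis (mono_tags, lifting) continuous_on_cong continuous_on_scaleR continuous_on_const)
qed

lemma continuous_im_norm [continuous_intros]: "continuous_on A im_norm"
  unfolding im_norm_def by (intro continuous_intros)

lemma continuous_on_Iu:
  assumes "\<And>q. q \<in> A \<Longrightarrow> 0 < im_norm q" shows "continuous_on A Iu"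
proof -
  have "continuous_on A im_unit"
    unfolding im_unit_def using assms by (intro continuous_intros) force
  then show ?thesis
    using assms by (subst continuous_on_cong[OF refl Iu_eq]) auto
qed

text \<open>Every orbit meets the closed half plane of \<open>unit_i\<close>, so membership can be
  tested there.\<close>

lemma axially_symmetric_iff:
  assumes "axially_symmetric U"
  shows "qreal (q$1) + im_norm q *\<^sub>R unit_i \<in> U \<longleftrightarrow> q \<in> U"
proof (cases "im_norm q = 0")
  case True
  then show ?thesis using im_norm_0[of q] by auto
next
  case False
  then have "0 < im_norm q" using im_norm_nonneg[of q] by linarith
  then show ?thesis
    using assms im_unit[of q] unit_i_qS unfolding axially_symmetric_def by metis
qed

text \<open>Integer coefficients can be read off at nonreal points, where \<open>Iu\<close> is
  nonzero.\<close>

lemma im_norm_pos_exists: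
  assumes "open S" "q \<in> S" shows "\<exists>q'\<in>S. 0 < im_norm q'"
proof (cases "im_norm q = 0")
  case True
  obtain e where e: "e > 0" "ball q e \<subseteq> S" using assms open_contains_ball by blast
  define q' where "q' = qreal (q$1) + (e/2) *\<^sub>R unit_i"
  have "q' - q = (e/2) *\<^sub>R unit_i" using im_norm_0[OF True] by (simp add: q'_def)
  moreover have "norm unit_i = 1" by (simp add: norm_vec_def L2_set_def sum_4 unit_i_def vector_4)
  ultimately have "dist q q' < e" using e(1) by (simp add: dist_norm norm_minus_commute[of q])
  moreover have "0 < im_norm q'" using e(1) by (simp add: q'_def im_norm_add unit_i_qS)
  ultimately show ?thesis using e(2) by auto
next
  case False
  then show ?thesis using assms(2) im_norm_nonneg[of q] by (metis order_le_less)
qed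

text \<open>Approaching a real point inside the slice \<open>\<complex>\<^sub>i\<close> from the two half planes gives the limits
  \<open>n i\<close> and \<open>- n i\<close>.\<close>

lemma multiple_zero_at_real:
  fixes n :: int
  assumes S: "open S" "qreal x \<in> S" and f: "continuous_on S f"
    and n: "\<And>q. q \<in> S \<Longrightarrow> f q = of_int n *\<^sub>R Iu q"
  shows "n = 0"
proof -
  have lim: "of_int n *\<^sub>R I = f (qreal x)" if I: "I \<in> qS" for I
  proof -
    define p where "p m = qreal x + (1 / Suc m) *\<^sub>R I" for m :: nat
    have "(\<lambda>m. (1 / Suc m) *\<^sub>R I) \<longlonglongrightarrow> 0 *\<^sub>R I"
      using LIMSEQ_inverse_real_of_nat by (intro tendsto_intros) (simp add: inverse_eq_divide)
    then have p: "p \<longlonglongrightarrow> qreal x"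
      unfolding p_def using tendsto_add[OF tendsto_const[of "qreal x"]] by force
    have ev: "\<forall>\<^sub>F m in sequentially. p m \<in> S" using p S by (rule topological_tendstoD)
    have "isCont f (qreal x)" using f S by (simp add: continuous_on_eq_continuous_at)
    then have "(\<lambda>m. f (p m)) \<longlonglongrightarrow> f (qreal x)" using p by (rule isCont_tendsto_compose)
    moreover have "\<forall>\<^sub>F m in sequentially. f (p m) = of_int n *\<^sub>R I"
      using ev by eventually_elim (simp only: n, simp add: p_def Iu_add I)
    ultimately have "(\<lambda>m. of_int n *\<^sub>R I) \<longlonglongrightarrow> f (qreal x)" by (simp cong: filterlim_cong)
    then show ?thesis by (simp add: LIMSEQ_const_iff)
  qed
  have "(real_of_int n *\<^sub>R unit_i) $ 2 = (real_of_int n *\<^sub>R (- unit_i)) $ 2"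
    using lim[OF unit_i_qS] lim[OF minus_qS[OF unit_i_qS]] by (simp only:)
  then show ?thesis by (simp add: unit_i_def vector_4)
qed

subsection \<open>Planar coordinates\<close>

text \<open>The tangent makes planar sets bounded; the absolute value folds the plane along the real
  line, so that planar sets are open and symmetric.\<close>

definition quat_of_plane :: "real \<times> real \<Rightarrow> quat" where
  "quat_of_plane z = qreal (tan (fst z)) + tan \<bar>snd z\<bar> *\<^sub>R unit_i"

definition plane_of_quat :: "quat \<Rightarrow> real \<times> real" where
  "plane_of_quat q = (arctan (q$1), arctan (im_norm q))"

definition planar :: "quat set \<Rightarrow> (real \<times> real) set" where
  "planar U = {z \<in> {- (pi/2)<..<pi/2} \<times> {- (pi/2)<..<pi/2}. quat_of_plane z \<in> U}"

lemma plane_of_quat_mem_planar: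
  assumes "axially_symmetric U" shows "plane_of_quat q \<in> planar U \<longleftrightarrow> q \<in> U"
proof -
  have "quat_of_plane (plane_of_quat q) = qreal (q$1) + im_norm q *\<^sub>R unit_i"
    by (simp add: quat_of_plane_def plane_of_quat_def tan_arctan)
  then show ?thesis
    using arctan_bounded[of "q$1"] arctan_bounded[of "im_norm q"] axially_symmetric_iff[OF assms, of q]
    by (auto simp: planar_def) (auto simp: plane_of_quat_def)
qed

lemma plane_of_quat_of_plane:
  assumes "(x, y) \<in> planar U" "0 \<le> y"
  shows "plane_of_quat (quat_of_plane (x, y)) = (x, y)"
proof -
  have "0 \<le> tan y" using assms tan_pos_pi2_le[of y] by (auto simp: planar_def)
  then show ?thesis
    using assms by (simp add: plane_of_quat_def quat_of_plane_def im_norm_add fst_add unit_i_qS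
        planar_def arctan_tan del: vector_add_component)
qed

lemma open_planar:
  assumes "open U" shows "open (planar U)"
proof -
  have "continuous_on {- (pi/2)<..<pi/2} (tan :: real \<Rightarrow> real)"
    by (intro continuous_on_tan continuous_on_id ballI) (metis cos_gt_zero_pi greaterThanLessThan_iff less_irrefl)
  then have c: "continuous_on ({- (pi/2)<..<pi/2} \<times> {- (pi/2)<..<pi/2}) quat_of_plane"
    unfolding quat_of_plane_def
    by (intro continuous_intros; (rule continuous_on_compose2[where f = fst] continuous_on_compose2[where f = "\<lambda>z. \<bar>snd z\<bar>"]);
        (assumption | intro continuous_intros | auto))
  have "open (({- (pi/2)<..<pi/2} \<times> {- (pi/2)<..<pi/2}) \<inter> quat_of_plane -` U)"
    using c assms by (intro continuous_open_preimage open_Times) auto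
  moreover have "planar U = ({- (pi/2)<..<pi/2} \<times> {- (pi/2)<..<pi/2}) \<inter> quat_of_plane -` U"
    by (auto simp: planar_def)
  ultimately show ?thesis by simp
qed

lemma bounded_planar: "bounded (planar U)"
proof (rule bounded_subset)
  show "bounded ({- (pi/2)..pi/2} \<times> {- (pi/2)..pi/2})"
    by (intro bounded_Times) auto
qed (auto simp: planar_def)

lemma planar_sym: "(x, - y) \<in> planar U \<longleftrightarrow> (x, y) \<in> planar U"
  by (auto simp: planar_def quat_of_plane_def)

lemma open_vimage_plane_of_quat: "open W \<Longrightarrow> open (plane_of_quat -` W)"
  by (rule open_vimage) (auto simp: plane_of_quat_def[abs_def] intro!: continuous_intros)

lemma axially_symmetric_vimage: "axially_symmetric (plane_of_quat -` W)"
  unfolding axially_symmetric_def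
  by (simp add: plane_of_quat_def im_norm_add fst_add del: vector_add_component)

section \<open>Vanishing of the cohomology\<close>

lemma cech_delta_of_int:
  "cech_delta (\<lambda>N q. of_int (b (map f N)) *\<^sub>R Iu q) L q = of_int (cob b (map f L)) *\<^sub>R Iu q"
  by (simp add: cech_delta_def cob_def map_del_at scaleR_sum_left)

text \<open>Passes from cochains with values in multiples of \<open>Iu\<close> to integer cochains
  on the nerve. Those vanish on simplices that meet the real line, which is the role of
  \<open>X0\<close>.\<close>

lemma coboundary_if_nerve_acyclic:
  fixes V :: "'a \<Rightarrow> quat set"
  assumes V: "\<And>t. t \<in> X \<Longrightarrow> open (V t)"
    and UV: "\<And>t. t \<in> X \<Longrightarrow> U t \<in> \<U> \<and> open (U t) \<and> V t \<subseteq> U t"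
    and clique: "\<And>M. M \<noteq> [] \<Longrightarrow> set M \<subseteq> X \<Longrightarrow> M \<in> cliques X r \<longleftrightarrow> (\<Inter>t\<in>set M. V t) \<noteq> {}"
    and real: "\<And>M. M \<noteq> [] \<Longrightarrow> M \<in> cliques X r \<Longrightarrow> set M \<subseteq> X0 \<longleftrightarrow> (\<exists>x. qreal x \<in> (\<Inter>t\<in>set M. V t))"
    and acyclic: "\<And>c. (\<And>M. M \<in> cliques X r \<Longrightarrow> length M = Suc (Suc n) \<Longrightarrow> cob c M = 0) \<Longrightarrow>
       (\<And>M. M \<in> cliques X r \<Longrightarrow> set M \<subseteq> X0 \<Longrightarrow> length M = Suc n \<Longrightarrow> c M = 0) \<Longrightarrow>
       \<exists>b. (\<forall>M\<in>cliques X r. length M = Suc n \<longrightarrow> c M = cob b M) \<and> (\<forall>M. set M \<subseteq> X0 \<longrightarrow> b M = 0)"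
    and c: "IZ_cocycle \<U> n c" and n: "1 \<le> n"
  shows "\<exists>\<tau>. refines_via (V ` X) \<U> \<tau> \<and> IZ_coboundary (V ` X) n (pullback \<tau> c)"
proof -
  \<comment> \<open>Different vertices may have equal sets \<open>V t\<close>, so each member of the
    covering is given one chosen vertex.\<close>
  define idx where "idx = inv_into X V"
  have idx: "idx v \<in> X" "V (idx v) = v" if "v \<in> V ` X" for v
    using that by (auto simp: idx_def f_inv_into_f inv_into_into)
  define \<tau> where "\<tau> = (\<lambda>v. U (idx v))"
  have ref: "refines_via (V ` X) \<U> \<tau>"
    unfolding refines_via_def \<tau>_def using idx UV by metis
  have U_idx: "map U M \<in> multi_idx \<U> m" if "set M \<subseteq> X" "length M = Suc m" for M m
    using that UV by (auto simp: multi_idx_def)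
  have VU: "(\<Inter>t\<in>set M. V t) \<subseteq> inter_of (map U M)" if "set M \<subseteq> X" for M
    using that UV unfolding inter_of_def by fastforce
  define z where "z M = (SOME k::int. \<forall>q\<in>inter_of (map U M). c (map U M) q = of_int k *\<^sub>R Iu q)" for M
  have z: "c (map U M) q = of_int (z M) *\<^sub>R Iu q"
    if "set M \<subseteq> X" "length M = Suc n" "q \<in> inter_of (map U M)" for M q
  proof -
    have "\<exists>k::int. \<forall>q\<in>inter_of (map U M). c (map U M) q = of_int k *\<^sub>R Iu q"
      using c U_idx[OF that(1,2)] unfolding IZ_cocycle_def IZ_cochain_def by blast
    from someI_ex[OF this] show ?thesis using that(3) unfolding z_def by blast
  qed
  have "\<exists>b. (\<forall>M\<in>cliques X r. length M = Suc n \<longrightarrow> z M = cob b M) \<and> (\<forall>M. set M \<subseteq> X0 \<longrightarrow> b M = 0)"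
  proof (rule acyclic)
    fix M assume M: "M \<in> cliques X r" "length M = Suc (Suc n)"
    have MX: "set M \<subseteq> X" using M(1) by (simp add: cliques_def)
    have ne: "M \<noteq> []" using M(2) by auto
    then obtain q0 where "q0 \<in> (\<Inter>t\<in>set M. V t)" using clique[OF ne MX] M(1) by blast
    moreover have "open (\<Inter>t\<in>set M. V t)" using V MX by (intro open_INT) auto
    ultimately obtain q where q: "q \<in> (\<Inter>t\<in>set M. V t)" "0 < im_norm q"
      using im_norm_pos_exists by blast
    \<comment> \<open>Evaluating the cocycle equation at a nonreal point of the intersection yields
      the integer equation.\<close>
    have "0 = cech_delta c (map U M) q"
      using c U_idx[OF MX M(2)] VU[OF MX] q(1) unfolding IZ_cocycle_def by fastforce
    also have "\<dots> = (\<Sum>i<length M. (-1) ^ i *\<^sub>R (of_int (z (del_at i M)) *\<^sub>R Iu q))"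
      unfolding cech_delta_def length_map
    proof (rule sum.cong)
      fix i assume i: "i \<in> {..<length M}"
      have sub: "set (del_at i M) \<subseteq> set M" by (rule set_del_at_subset)
      then have "q \<in> inter_of (map U (del_at i M))"
        using VU[of "del_at i M"] MX q(1) by blast
      then show "(-1) ^ i *\<^sub>R c (del_at i (map U M)) q = (-1) ^ i *\<^sub>R (of_int (z (del_at i M)) *\<^sub>R Iu q)"
        using z[of "del_at i M" q] sub MX i M(2) by (simp add: length_del_at flip: map_del_at)
    qed simp
    also have "\<dots> = of_int (cob z M) *\<^sub>R Iu q"
      by (simp add: cob_def scaleR_sum_left)
    finally show "cob z M = 0" using Iu_nonzero[OF q(2)] by simp
  next
    fix M assume M: "M \<in> cliques X r" "set M \<subseteq> X0" "length M = Suc n"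
    have MX: "set M \<subseteq> X" using M(1) by (simp add: cliques_def)
    have ne: "M \<noteq> []" using M(3) by auto
    obtain x where x: "qreal x \<in> inter_of (map U M)" using real[OF ne M(1)] M(2) VU[OF MX] by blast
    have "open (inter_of (map U M))"
      unfolding inter_of_def using UV MX by (intro open_Inter) auto
    moreover have "continuous_on (inter_of (map U M)) (c (map U M))"
      using c U_idx[OF MX M(3)] unfolding IZ_cocycle_def IZ_cochain_def by blast
    ultimately show "z M = 0"
      using multiple_zero_at_real[OF _ x _ z[OF MX M(3)]] by simp
  qed
  then obtain b where b: "\<And>M. M \<in> cliques X r \<Longrightarrow> length M = Suc n \<Longrightarrow> z M = cob b M"
    "\<And>M. set M \<subseteq> X0 \<Longrightarrow> b M = 0" by blast
  have inter_idx: "inter_of L = (\<Inter>t\<in>set (map idx L). V t)" if "set L \<subseteq> V ` X" for L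
  proof -
    have "(\<Inter>t\<in>set (map idx L). V t) = (\<Inter>v\<in>set L. V (idx v))" by simp
    also have "\<dots> = (\<Inter>v\<in>set L. v)"
      by (intro INF_cong refl idx(2)) (use that in blast)
    finally show ?thesis by (simp add: inter_of_def)
  qed
  define B where "B L q = of_int (b (map idx L)) *\<^sub>R Iu q" for L q
  have "IZ_coboundary (V ` X) n (pullback \<tau> c)"
    unfolding IZ_coboundary_def
  proof (intro exI[of _ B] conjI ballI)
    show "IZ_cochain (V ` X) (n - 1) B"
      unfolding IZ_cochain_def
    proof (intro ballI conjI)
      fix L assume "L \<in> multi_idx (V ` X) (n - 1)"
      then have L: "set L \<subseteq> V ` X" "L \<noteq> []" by (auto simp: multi_idx_def)
      have iX: "set (map idx L) \<subseteq> X" using L(1) idx by auto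
      show "continuous_on (inter_of L) (B L)"
      \<comment> \<open>On intersections meeting the real line \<open>b\<close> vanishes, so
        \<open>B\<close> is zero; elsewhere \<open>Iu\<close> is continuous.\<close>
      proof (cases "\<exists>x. qreal x \<in> inter_of L")
        case True
        then have "map idx L \<in> cliques X r"
          using clique[of "map idx L"] L iX inter_idx by auto
        then have "set (map idx L) \<subseteq> X0"
          using real[of "map idx L"] True inter_idx[OF L(1)] L(2) by auto
        then show ?thesis using b(2) by (simp add: B_def[abs_def])
      next
        case False
        then have "0 < im_norm q" if "q \<in> inter_of L" for q
          using that im_norm_0[of q] im_norm_nonneg[of q] by (metis order_le_less)
        then have "continuous_on (inter_of L) Iu" by (rule continuous_on_Iu)
        then show ?thesis unfolding B_def by (intro continuous_intros)
      qed
      show "\<exists>k::int. \<forall>q\<in>inter_of L. B L q = of_int k *\<^sub>R Iu q" by (auto simp: B_def)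
    qed
  next
    fix L q assume L: "L \<in> multi_idx (V ` X) n" and q: "q \<in> inter_of L"
    then have LV: "set L \<subseteq> V ` X" "L \<noteq> []" "length L = Suc n" by (auto simp: multi_idx_def)
    have iX: "set (map idx L) \<subseteq> X" using LV(1) idx by auto
    have cl: "map idx L \<in> cliques X r"
      using clique[of "map idx L"] LV(2) iX inter_idx[OF LV(1)] q by auto
    have "pullback \<tau> c L q = c (map U (map idx L)) q"
      by (simp add: pullback_def \<tau>_def comp_def)
    also have "\<dots> = of_int (z (map idx L)) *\<^sub>R Iu q"
      using VU[OF iX] q inter_idx[OF LV(1)] LV(3) by (intro z[OF iX]) auto
    also have "\<dots> = cech_delta B L q"
      using b(1)[OF cl] LV(3) cech_delta_of_int[of b idx L q] by (simp add: B_def[abs_def])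
    finally show "pullback \<tau> c L q = cech_delta B L q" .
  qed
  then show ?thesis using ref by blast
qed

theorem mainTheorem6:
  assumes "axially_symmetric_domain \<Omega>"
    and "n \<ge> 2"
  shows "IZ_cohomology_vanishes \<Omega> n"
  unfolding IZ_cohomology_vanishes_def
proof (intro allI impI)
  fix \<U> c assume U: "as_covering \<U> \<Omega>" and c: "IZ_cocycle \<U> n c"
  have Om: "open \<Omega>" "axially_symmetric \<Omega>"
    using assms(1) by (auto simp: axially_symmetric_domain_def)
  have U_prop: "\<And>u. u \<in> \<U> \<Longrightarrow> open u \<and> axially_symmetric u \<and> u \<subseteq> \<Omega>" "\<Union>\<U> = \<Omega>"
    using U by (auto simp: as_covering_def)
  have "planar \<Omega> \<subseteq> \<Union> (planar ` \<U>)" using U_prop(2) by (auto simp: planar_def)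
  then obtain a where a: "tiling (planar \<Omega>) a"
    and small: "\<And>j z. z \<in> core (planar \<Omega>) j \<Longrightarrow> \<exists>A\<in>planar ` \<U>. ball z (4 / 2 ^ a j) \<subseteq> A"
    using exists_tiling[of "planar \<Omega>" "planar ` \<U>"] bounded_planar planar_sym open_planar U_prop(1)
    by (metis (no_types, lifting) image_iff)
  interpret tiling "planar \<Omega>" a by (rule a)
  \<comment> \<open>An enlarged tile fits in a ball of radius four meshes about a point of its core,
    hence in one member of the covering.\<close>
  have "\<exists>u\<in>\<U>. wide t \<subseteq> planar u" if "t \<in> tiles" for t
    using wide_small small that by (cases t) (metis (no_types, lifting) image_iff subset_trans)
  then obtain u where u: "\<And>t. t \<in> tiles \<Longrightarrow> u t \<in> \<U> \<and> wide t \<subseteq> planar (u t)" by metis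
  define V where "V t = plane_of_quat -` wide t" for t
  have VU: "V t \<subseteq> u t" if "t \<in> tiles" for t
  proof
    fix q assume "q \<in> V t"
    then have "plane_of_quat q \<in> planar (u t)" using u[OF that] unfolding V_def by blast
    then show "q \<in> u t" using plane_of_quat_mem_planar U_prop(1) u[OF that] by blast
  qed
  have V_open: "open (V t)" for t
    unfolding V_def by (intro open_vimage_plane_of_quat open_wide)
  have cov: "as_covering (V ` tiles) \<Omega>"
    unfolding as_covering_def
  proof (intro conjI ballI equalityI subsetI)
    fix v assume v: "v \<in> V ` tiles"
    show "open v" "axially_symmetric v"
      using v V_open axially_symmetric_vimage by (auto simp: V_def)
    fix q assume "q \<in> v"
    then show "q \<in> \<Omega>" using v VU u U_prop by blast
  next
    fix q assume "q \<in> \<Union> (V ` tiles)"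
    then show "q \<in> \<Omega>" using VU u U_prop by blast
  next
    fix q assume "q \<in> \<Omega>"
    then have "plane_of_quat q \<in> planar \<Omega>" using plane_of_quat_mem_planar[OF Om(2)] by blast
    then have "\<exists>t\<in>tiles. plane_of_quat q \<in> wide t"
      using tiles_cover[OF open_planar[OF Om(1)]] by (auto simp: plane_of_quat_def)
    then show "q \<in> \<Union> (V ` tiles)" by (auto simp: V_def)
  qed
  \<comment> \<open>Only the upper half plane is the image of quaternions, which is why common
    points of cliques were chosen with \<open>0 \<le> y\<close>.\<close>
  have point: "quat_of_plane (x, y) \<in> V t" if "t \<in> tiles" "(x, y) \<in> wide t" "0 \<le> y" for x y t
    using plane_of_quat_of_plane[of x y "u t"] u[OF that(1)] that by (auto simp: V_def)
  have "\<exists>\<tau>. refines_via (V ` tiles) \<U> \<tau> \<and> IZ_coboundary (V ` tiles) n (pullback \<tau> c)"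
  proof (rule coboundary_if_nerve_acyclic[where U = u and V = V and X = tiles and X0 = bottom and r = touches and n = n and c = c])
    show "M \<in> cliques tiles touches \<longleftrightarrow> (\<Inter>t\<in>set M. V t) \<noteq> {}" if M: "M \<noteq> []" "set M \<subseteq> tiles" for M
    proof
      assume "M \<in> cliques tiles touches"
      then obtain x y where "0 \<le> y" "\<forall>t\<in>set M. (x, y) \<in> wide t"
        using clique_common_point M(1) by blast
      then have "quat_of_plane (x, y) \<in> (\<Inter>t\<in>set M. V t)" using point M(2) by blast
      then show "(\<Inter>t\<in>set M. V t) \<noteq> {}" by blast
    next
      assume "(\<Inter>t\<in>set M. V t) \<noteq> {}"
      then obtain q where "\<And>t. t \<in> set M \<Longrightarrow> plane_of_quat q \<in> wide t" by (auto simp: V_def)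
      then show "M \<in> cliques tiles touches" using M(2) clique_if_common_point by blast
    qed
    show "set M \<subseteq> bottom \<longleftrightarrow> (\<exists>x. qreal x \<in> (\<Inter>t\<in>set M. V t))"
      if M: "M \<noteq> []" "M \<in> cliques tiles touches" for M
    proof
      have MX: "set M \<subseteq> tiles" using M(2) by (simp add: cliques_def)
      assume "set M \<subseteq> bottom"
      then obtain x where "\<forall>t\<in>set M. (x, 0) \<in> wide t"
        using clique_common_point[OF M(2,1)] by blast
      then have "quat_of_plane (x, 0) \<in> (\<Inter>t\<in>set M. V t)" using point MX by blast
      then show "\<exists>x. qreal x \<in> (\<Inter>t\<in>set M. V t)" by (auto simp: quat_of_plane_def)
    next
      have MX: "set M \<subseteq> tiles" using M(2) by (simp add: cliques_def)
      assume "\<exists>x. qreal x \<in> (\<Inter>t\<in>set M. V t)"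
      then obtain x where "\<And>t. t \<in> set M \<Longrightarrow> (arctan x, 0) \<in> wide t"
        by (auto simp: V_def plane_of_quat_def im_norm_def)
      then show "set M \<subseteq> bottom" using bottom_if_wide_0 MX by blast
    qed
    show "\<exists>b. (\<forall>M\<in>cliques tiles touches. length M = Suc n \<longrightarrow> z M = cob b M) \<and> (\<forall>M. set M \<subseteq> bottom \<longrightarrow> b M = 0)"
      if "\<And>M. M \<in> cliques tiles touches \<Longrightarrow> length M = Suc (Suc n) \<Longrightarrow> cob z M = 0"
        "\<And>M. M \<in> cliques tiles touches \<Longrightarrow> set M \<subseteq> bottom \<Longrightarrow> length M = Suc n \<Longrightarrow> z M = 0" for z
      \<comment> \<open>Degree \<open>n\<close> means lists of length \<open>Suc n\<close>, so
        \<open>n \<ge> 2\<close> supplies the bound 3 required there.\<close>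
      using that assms(2) by (intro tiles_acyclic) auto
  qed (use V_open u U_prop VU c assms(2) in auto)
  then show "\<exists>\<V> \<tau>. as_covering \<V> \<Omega> \<and> refines_via \<V> \<U> \<tau> \<and> IZ_coboundary \<V> n (pullback \<tau> c)"
    using cov by blast
qed

end
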